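(* Let $D$ be an integral domain that is a subring of a finite field extension of $\mathbb Q$, and let $d\ge 2$. In the Coefficient-Choosing Game with parameters $D$ and $d$, the player who makes the last play has a winning strategy.
   Context: The Coefficient-Choosing Game with parameters an integral domain $D$ and a degree $d\ge 2$: one of two players, Wanda or Nora, is designated Player I and the other Player II. Starting with Player I, the players alternately choose the coefficients $a_0,\dots,a_d\in D$ of a polynomial $f(x)=a_dx^d+\cdots+a_1x+a_0$; on each turn the player picks any not-yet-chosen index $i$ (the order is not predetermined) and a value $a_i\in D$, subject to the rule that $a_d\neq 0$ and $a_0\neq 0$. When all $d+1$ coefficients are chosen, Wanda wins if $f$ has a root in the field of fractions of $D$, and Nora wins otherwise. "A player wins" means that player has a strategy that wins no matter how the other plays. *)

theory Defs
  imports "HOL-Computational_Algebra.Computational_Algebra"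
begin

definition rat_scale :: "rat \<Rightarrow> 'k::field_char_0 \<Rightarrow> 'k" where
  "rat_scale q x = of_rat q * x"

lemma vector_space_rat_scale: "vector_space (rat_scale :: rat \<Rightarrow> 'k \<Rightarrow> 'k::field_char_0)"
  by unfold_locales (simp_all add: rat_scale_def algebra_simps of_rat_add of_rat_mult)

text \<open>A field of characteristic 0 contains the rationals via \<^const>\<open>of_rat\<close>; it is a finite
  extension iff some finite set spans it over them.\<close>

definition finite_extension_of_rats :: "'k::field_char_0 itself \<Rightarrow> bool" where
  "finite_extension_of_rats _ \<longleftrightarrow>
     (\<exists>B :: 'k set. finite B \<and> module.span rat_scale B = UNIV)"

text \<open>``Subring of'' for a ring given as a type: an injective unital ring homomorphism.\<close>

definition ring_embedding :: "('a::idom \<Rightarrow> 'k::field) \<Rightarrow> bool" where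
  "ring_embedding h \<longleftrightarrow> inj h \<and> h 1 = 1 \<and>
     (\<forall>x y. h (x + y) = h x + h y) \<and> (\<forall>x y. h (x * y) = h x * h y)"

datatype player = Wanda | Nora

fun opponent :: "player \<Rightarrow> player" where
  "opponent Wanda = Nora"
| "opponent Nora = Wanda"

text \<open>\<open>mover first k\<close> makes the move that comes after \<open>k\<close> earlier ones, \<open>first\<close> being Player I.\<close>

definition mover :: "player \<Rightarrow> nat \<Rightarrow> player" where
  "mover first k = (if even k then first else opponent first)"

text \<open>The move \<open>(i, a)\<close> sets the coefficient of \<open>x^i\<close> to \<open>a\<close>. A history lists the moves made so
  far, earliest first.\<close>

type_synonym 'a history = "(nat \<times> 'a) list"

definition legal_move :: "nat \<Rightarrow> 'a::zero history \<Rightarrow> nat \<times> 'a \<Rightarrow> bool" where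
  "legal_move d ms m \<longleftrightarrow>
     fst m \<le> d \<and> fst m \<notin> fst ` set ms \<and> (fst m = 0 \<or> fst m = d \<longrightarrow> snd m \<noteq> 0)"

definition legal_history :: "nat \<Rightarrow> 'a::zero history \<Rightarrow> bool" where
  "legal_history d ms \<longleftrightarrow> (\<forall>k < length ms. legal_move d (take k ms) (ms ! k))"

definition game_poly :: "'a::comm_monoid_add history \<Rightarrow> 'a poly" where
  "game_poly ms = (\<Sum>(i, a) \<leftarrow> ms. monom a i)"

definition has_root_in_fract :: "'a::idom poly \<Rightarrow> bool" where
  "has_root_in_fract f \<longleftrightarrow> (\<exists>x :: 'a fract. poly (map_poly to_fract f) x = 0)"

fun won_by :: "player \<Rightarrow> 'a::idom poly \<Rightarrow> bool" where
  "won_by Wanda f \<longleftrightarrow> has_root_in_fract f"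
| "won_by Nora f \<longleftrightarrow> \<not> has_root_in_fract f"

definition follows :: "player \<Rightarrow> player \<Rightarrow> ('a history \<Rightarrow> nat \<times> 'a) \<Rightarrow> 'a history \<Rightarrow> bool" where
  "follows first P \<sigma> ms \<longleftrightarrow>
     (\<forall>k < length ms. mover first k = P \<longrightarrow> ms ! k = \<sigma> (take k ms))"

text \<open>The strategy must name a legal move whenever \<open>P\<close> is to play, and every complete play (that
  is, of \<open>d + 1\<close> moves) that follows it must be won by \<open>P\<close>. Only histories in which \<open>P\<close> has
  followed \<open>\<sigma>\<close> matter; the opponent's moves in them are arbitrary legal ones.\<close>

definition winning_strategy ::
  "nat \<Rightarrow> player \<Rightarrow> player \<Rightarrow> ('a::idom history \<Rightarrow> nat \<times> 'a) \<Rightarrow> bool" where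
  "winning_strategy d first P \<sigma> \<longleftrightarrow>
     (\<forall>ms. legal_history d ms \<and> follows first P \<sigma> ms \<longrightarrow>
        (length ms < d + 1 \<and> mover first (length ms) = P \<longrightarrow> legal_move d ms (\<sigma> ms)) \<and>
        (length ms = d + 1 \<longrightarrow> won_by P (game_poly ms)))"

text \<open>The last of the \<open>d + 1\<close> moves is preceded by \<open>d\<close> others.\<close>

definition last_player :: "nat \<Rightarrow> player \<Rightarrow> player" where
  "last_player d first = mover first d"

end

(*
  Only the last move matters: any legal history of d moves can be completed to a win for
  either player.

  Wanda: the open coefficient is determined by requiring a root at x = 1, at an x with
  g(x) <> 0 (if the constant coefficient is open), or at 1/y (if the leading one is).

  Nora: she plays an integer. Choose a place of degree one of a number field containing all
  data, with residue field F_p, at which the relevant elements are units.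
  If a middle coefficient a_i is open, then g(y) + a y^i = 0 determines a from y in F_p^*;
  there are only p - 1 such y, so some residue a is never hit. If a_0 is open, pick an integer z
  and some w <> z, algebraic over the field, with g(w) = g(z), and let the number field contain w;
  then g is not injective on F_p, hence not surjective, and again some residue is missed. The
  leading coefficient is reduced to this case by reversing the polynomial. Roots in the field
  are integral at the place because the leading coefficient is a unit, so they would reduce to
  roots modulo p.

  Places of degree one come from a primitive element theta with minimal integer polynomial m: some
  large prime p divides a value m(r), and Hensel's lemma makes r a p-adic root of m.
*)

theory Submission
  imports "HOL-Algebra.Algebraic_Closure_Type" "HOL-Number_Theory.Cong" Defs
begin

section \<open>Simple extensions of the rationals\<close>

text \<open>Integer rather than rational coefficients: the same polynomial is evaluated at field
  elements and, modulo powers of a prime, at integers.\<close>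

definition ipoly :: "int poly \<Rightarrow> 'c::field_char_0 \<Rightarrow> 'c" where
  "ipoly q x = poly (map_poly of_int q) x"

lemma ipoly_0 [simp]: "ipoly 0 x = 0"
  by (simp add: ipoly_def)

lemma ipoly_pCons [simp]: "ipoly (pCons a q) x = of_int a + x * ipoly q x"
  by (simp add: ipoly_def map_poly_pCons)

lemma ipoly_add [simp]: "ipoly (q + r) x = ipoly q x + ipoly r x"
  by (induction q r rule: poly_induct2) (simp_all add: algebra_simps)

lemma ipoly_uminus [simp]: "ipoly (- q) x = - ipoly q x"
  by (induction q) (simp_all add: algebra_simps)

lemma ipoly_diff [simp]: "ipoly (q - r) x = ipoly q x - ipoly r x"
  using ipoly_add[of q "- r" x] by simp

lemma ipoly_smult [simp]: "ipoly (smult a q) x = of_int a * ipoly q x"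
  by (induction q) (simp_all add: algebra_simps)

lemma ipoly_mult [simp]: "ipoly (q * r) x = ipoly q x * ipoly r x"
  by (induction q) (simp_all add: algebra_simps)

lemma ipoly_monom [simp]: "ipoly (monom a n) x = of_int a * x ^ n"
  by (simp add: ipoly_def map_poly_monom poly_monom)

lemma ipoly_pcompose: "ipoly (q \<circ>\<^sub>p r) x = ipoly q (ipoly r x)"
  by (induction q) (simp_all add: pcompose_pCons)

definition algebraic_over_Z :: "'c::field_char_0 \<Rightarrow> bool" where
  "algebraic_over_Z x \<longleftrightarrow> (\<exists>e. e \<noteq> 0 \<and> ipoly e x = 0)"

text \<open>Since \<open>x\<close> is nonzero, factors X of an annihilating polynomial can be
  cancelled until the constant term survives.\<close>

lemma algebraic_nonzero_const:
  assumes "algebraic_over_Z x" "x \<noteq> 0"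
  obtains e where "ipoly e x = 0" "coeff e 0 \<noteq> 0"
proof -
  obtain e where "e \<noteq> 0" "ipoly e x = 0" using assms(1) by (auto simp: algebraic_over_Z_def)
  then have "\<exists>e. ipoly e x = 0 \<and> coeff e 0 \<noteq> 0"
  proof (induction e)
    case 0 then show ?case by simp
  next
    case (pCons a e)
    show ?case
    proof (cases "a = 0")
      case True
      with pCons assms(2) show ?thesis by auto
    next
      case False
      then show ?thesis using pCons.prems by (intro exI[of _ "pCons a e"]) auto
    qed
  qed
  then show thesis using that by blast
qed

text \<open>The ring generated by \<theta> over the rationals, with denominators cleared; it is a
  field as soon as its elements are algebraic, by \<open>Qadj_inverse\<close>.\<close>

definition Qadj :: "'c::field_char_0 \<Rightarrow> 'c set" where
  "Qadj \<theta> = {x. \<exists>N q. N \<noteq> 0 \<and> of_int N * x = ipoly q \<theta>}"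

lemma QadjI: "N \<noteq> 0 \<Longrightarrow> of_int N * x = ipoly q \<theta> \<Longrightarrow> x \<in> Qadj \<theta>"
  by (auto simp: Qadj_def)

lemma QadjE:
  assumes "x \<in> Qadj \<theta>" obtains N q where "N \<noteq> 0" "of_int N * x = ipoly q \<theta>"
  using assms by (auto simp: Qadj_def)

lemma of_int_Qadj [simp, intro]: "of_int a \<in> Qadj \<theta>"
  by (rule QadjI[of 1 _ "[:a:]"]) auto

lemma self_Qadj [simp, intro]: "\<theta> \<in> Qadj \<theta>"
  by (rule QadjI[of 1 _ "[:0, 1:]"]) auto

lemma Qadj_add [intro]: assumes "x \<in> Qadj \<theta>" "y \<in> Qadj \<theta>" shows "x + y \<in> Qadj \<theta>"
proof -
  obtain N q where 1: "N \<noteq> 0" "of_int N * x = ipoly q \<theta>" using assms(1) by (rule QadjE)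
  obtain M r where 2: "M \<noteq> 0" "of_int M * y = ipoly r \<theta>" using assms(2) by (rule QadjE)
  show ?thesis
    using 1(1) 2(1) by (intro QadjI[of "N * M" _ "smult M q + smult N r"])
      (simp_all add: algebra_simps flip: 1(2) 2(2))
qed

lemma Qadj_mult [intro]: assumes "x \<in> Qadj \<theta>" "y \<in> Qadj \<theta>" shows "x * y \<in> Qadj \<theta>"
proof -
  obtain N q where 1: "N \<noteq> 0" "of_int N * x = ipoly q \<theta>" using assms(1) by (rule QadjE)
  obtain M r where 2: "M \<noteq> 0" "of_int M * y = ipoly r \<theta>" using assms(2) by (rule QadjE)
  show ?thesis
    using 1(1) 2(1) by (intro QadjI[of "N * M" _ "q * r"]) (simp_all flip: 1(2) 2(2))
qed

lemma Qadj_uminus [intro]: "x \<in> Qadj \<theta> \<Longrightarrow> - x \<in> Qadj \<theta>"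
  using Qadj_mult[OF of_int_Qadj[of "- 1"], of x] by simp

lemma Qadj_diff [intro]: "x \<in> Qadj \<theta> \<Longrightarrow> y \<in> Qadj \<theta> \<Longrightarrow> x - y \<in> Qadj \<theta>"
  using Qadj_add[of x \<theta> "- y"] by auto

text \<open>Splitting off the constant term \<open>a\<close> of a relation for
  \<open>ipoly q \<theta>\<close> exhibits \<open>a\<close> as a multiple of it. The inverse is thus
  integral up to one integer, whose prime factors can be controlled later.\<close>

lemma ipoly_inverse_witness:
  assumes "algebraic_over_Z (ipoly q \<theta>)" "ipoly q \<theta> \<noteq> 0"
  obtains c s where "c \<noteq> 0" "ipoly s \<theta> * ipoly q \<theta> = of_int c"
proof -
  obtain e where e: "ipoly e (ipoly q \<theta>) = 0" "coeff e 0 \<noteq> 0"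
    using algebraic_nonzero_const[OF assms] by blast
  obtain a e' where "e = pCons a e'" by (cases e)
  with e have a: "a \<noteq> 0" "of_int a + ipoly q \<theta> * ipoly e' (ipoly q \<theta>) = 0" by auto
  show thesis
  proof (rule that)
    show "ipoly (- (e' \<circ>\<^sub>p q)) \<theta> * ipoly q \<theta> = of_int a"
      using a(2) by (simp add: ipoly_pcompose add_eq_0_iff2 algebra_simps)
  qed (use a in simp)
qed

lemma Qadj_inverse:
  assumes "x \<in> Qadj \<theta>" "\<And>x. x \<in> Qadj \<theta> \<Longrightarrow> algebraic_over_Z x"
  shows "inverse x \<in> Qadj \<theta>"
proof (cases "x = 0")
  case True then show ?thesis using of_int_Qadj[of 0 \<theta>] by simp
next
  case False
  obtain N q where 1: "N \<noteq> 0" "of_int N * x = ipoly q \<theta>" using assms(1) by (rule QadjE)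
  have "ipoly q \<theta> \<in> Qadj \<theta>" by (rule QadjI[of 1]) auto
  moreover have "ipoly q \<theta> \<noteq> 0" using 1 False by (metis mult_eq_0_iff of_int_eq_0_iff)
  ultimately obtain c s where "c \<noteq> 0" "ipoly s \<theta> * ipoly q \<theta> = of_int c"
    using ipoly_inverse_witness assms(2) by metis
  with 1(1) False show ?thesis
    by (intro QadjI[of c _ "smult N s"]) (simp_all add: field_simps flip: 1(2))
qed

lemma minimal_ipoly:
  assumes "algebraic_over_Z \<theta>"
  obtains m where "m \<noteq> 0" "ipoly m \<theta> = 0" "\<And>q. q \<noteq> 0 \<Longrightarrow> ipoly q \<theta> = 0 \<Longrightarrow> degree m \<le> degree q"
  using assms ex_has_least_nat[of "\<lambda>q. q \<noteq> 0 \<and> ipoly q \<theta> = 0" _ degree]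
  unfolding algebraic_over_Z_def by blast

text \<open>The remainder of pseudo-division kills \<theta> and has smaller degree, so it vanishes.
  The power of the leading coefficient is harmless at primes that do not divide it.\<close>

lemma minimal_ipoly_dvd:
  assumes "m \<noteq> 0" "ipoly m \<theta> = 0" "\<And>q. q \<noteq> 0 \<Longrightarrow> ipoly q \<theta> = 0 \<Longrightarrow> degree m \<le> degree q"
    and "ipoly q \<theta> = 0"
  shows "\<exists>n. m dvd smult (lead_coeff m ^ n) q"
proof -
  obtain w r where wr: "pseudo_divmod q m = (w, r)" by fastforce
  from pseudo_divmod[OF assms(1) this] obtain n where
    n: "smult (lead_coeff m ^ n) q = m * w + r" "r = 0 \<or> degree r < degree m" by blast
  from arg_cong[OF n(1), of "\<lambda>u. ipoly u \<theta>"] have "ipoly r \<theta> = 0" using assms by simp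
  with n(2) assms(3)[of r] have "r = 0" by fastforce
  with n(1) show ?thesis by (auto intro: exI[of _ n])
qed

lemma poly_diff_dvd_int: "(a - b :: int) dvd poly q a - poly q b"
proof -
  have "[poly q a = poly q b] (mod (a - b))"
  proof (induction q)
    case (pCons c q)
    have "[a = b] (mod (a - b))" by (simp add: cong_iff_dvd_diff)
    with pCons show ?case by (simp add: cong_add cong_mult)
  qed simp
  then show ?thesis by (simp add: cong_iff_dvd_diff)
qed

section \<open>Places of degree one\<close>

text \<open>Schur's variant of Euclid's argument: \<open>m\<close> takes the value \<open>m 0 * (1 + E * (t * u))\<close> at
  \<open>E * m 0 * t\<close>, and the second factor is prime to \<open>E\<close>.\<close>

lemma prime_divisor_of_values:
  fixes m :: "int poly"
  assumes "degree m > 0" "E \<noteq> 0"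
  obtains p r where "prime p" "\<not> p dvd E" "p dvd poly m r"
proof (cases "poly m 0 = 0")
  case True
  obtain p :: nat where p: "prime p" "p > nat \<bar>E\<bar>" using bigger_prime by blast
  have "\<not> int p dvd E"
    using p(2) assms(2) zdvd_imp_le[of "int p" "\<bar>E\<bar>"] by auto
  with p True that[of "int p" 0] show thesis by auto
next
  case False
  define b where "b = poly m 0"
  \<comment> \<open>Off these finitely many points the cofactor \<open>1 + E * (t * u)\<close> is
    neither a unit nor zero, so it has a prime divisor.\<close>
  define excluded where "excluded = {x. poly (m - [:b:]) x = 0} \<union> {x. poly (m + [:b:]) x = 0} \<union> {x. poly m x = 0}"
  have "m - [:b:] \<noteq> 0" "m + [:b:] \<noteq> 0"
    using assms(1) degree_add_eq_left[of "[:b:]" m] degree_add_eq_left[of "- [:b:]" m] by auto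
  moreover have "m \<noteq> 0" using assms(1) by auto
  ultimately have "finite excluded" unfolding excluded_def by (simp add: poly_roots_finite del: poly_diff poly_add)
  moreover have "inj (\<lambda>t::int. E * b * t)" using assms(2) False by (auto simp: inj_def b_def)
  then have "infinite (range (\<lambda>t::int. E * b * t))"
    by (auto dest: finite_imageD)
  ultimately obtain t where t: "E * b * t \<notin> excluded" by (meson finite_subset image_subsetI)
  define x where "x = E * b * t"
  have "x dvd poly m x - b" using poly_diff_dvd_int[of x 0 m] by (simp add: b_def)
  then obtain u where u: "poly m x = b * (1 + E * (t * u))"
    by (auto simp: x_def dvd_def algebra_simps)
  have "\<not> is_unit (1 + E * (t * u))"
  proof
    assume "is_unit (1 + E * (t * u))"
    then have "1 + E * (t * u) = 1 \<or> 1 + E * (t * u) = -1"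
      by (simp only: zdvd1_eq) linarith
    then have "poly m x = b \<or> poly m x = - b"
      by (elim disjE) (simp_all only: u mult_1_right mult_minus_right simp_thms)
    then show False using t unfolding excluded_def x_def[symmetric] by auto
  qed
  moreover have "1 + E * (t * u) \<noteq> 0"
    using t u unfolding excluded_def x_def[symmetric] by auto
  ultimately obtain p where p: "prime p" "p dvd 1 + E * (t * u)"
    using prime_divisor_exists by blast
  have "\<not> p dvd E"
  proof
    assume "p dvd E"
    then have "p dvd 1" using p(2) by (metis dvd_add_left_iff dvd_mult2)
    then show False using p(1) not_prime_unit by blast
  qed
  with p u that[of p x] show thesis by auto
qed

text \<open>Newton's correction: \<open>h\<close> is minus \<open>poly m r\<close> times an inverse
  \<open>v\<close> of the derivative modulo \<open>p\<close>, and the Taylor remainder is divisible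
  by the square of \<open>h\<close>. The fixed start \<open>r0\<close> carries the condition on the
  derivative, which every \<open>r\<close> congruent to it inherits.\<close>

lemma hensel_step:
  fixes m :: "int poly"
  assumes "p dvd r - r0" "\<not> p dvd poly (pderiv m) r0" "prime p" "p ^ Suc k dvd poly m r"
  shows "\<exists>r'. p ^ Suc k dvd r' - r \<and> p ^ Suc (Suc k) dvd poly m r'"
proof -
  have taylor: "h\<^sup>2 dvd poly m (r + h) - (poly m r + h * poly (pderiv m) r)" for h
  proof (induction m)
    case (pCons a m)
    have "poly (pCons a m) (r + h) - (poly (pCons a m) r + h * poly (pderiv (pCons a m)) r) =
      (r + h) * (poly m (r + h) - (poly m r + h * poly (pderiv m) r)) + h\<^sup>2 * poly (pderiv m) r"
      by (simp add: pderiv_pCons algebra_simps power2_eq_square)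
    then show ?case using pCons by (metis dvd_add dvd_mult dvd_triv_left)
  qed simp
  have "\<not> p dvd poly (pderiv m) r"
    using assms(1,2) poly_diff_dvd_int[of r r0 "pderiv m"] by (meson dvd_diff_commute dvd_trans zdvd_zdiffD)
  then have "coprime (poly (pderiv m) r) p"
    using assms(3) by (metis coprime_commute prime_imp_coprime)
  then obtain v where v: "[poly (pderiv m) r * v = 1] (mod p)" using cong_solve_coprime_int by blast
  obtain b where b: "poly m r = p ^ Suc k * b" using assms(4) by (auto simp: dvd_def)
  define h where "h = p ^ Suc k * (- b * v)"
  have "p ^ Suc (Suc k) dvd (p ^ Suc k) ^ 2"
    unfolding power_mult[symmetric] by (rule le_imp_power_dvd) simp
  then have "p ^ Suc (Suc k) dvd h\<^sup>2" by (simp add: h_def power_mult_distrib del: power_Suc)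
  moreover have "p dvd 1 - poly (pderiv m) r * v"
    using v by (metis cong_iff_dvd_diff dvd_diff_commute)
  then have "p ^ Suc k * p dvd p ^ Suc k * (b * (1 - poly (pderiv m) r * v))" 
    by (intro mult_dvd_mono) auto
  then have "p ^ Suc (Suc k) dvd poly m r + h * poly (pderiv m) r"
    unfolding h_def b by (simp add: algebra_simps)
  ultimately have "p ^ Suc (Suc k) dvd poly m (r + h)"
    using taylor[of h] by (meson dvd_trans zdvd_zdiffD)
  then show ?thesis by (intro exI[of _ "r + h"]) (simp add: h_def)
qed

text \<open>Iterating \<open>hensel_step\<close> gives a Cauchy sequence for the p-adic topology.
  The congruence with \<open>r\<close> is kept as an invariant because each further step needs
  it.\<close>

lemma hensel_sequence:
  fixes m :: "int poly"
  assumes "prime p" "p dvd poly m r" "\<not> p dvd poly (pderiv m) r"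
  obtains s where "\<And>k. p ^ Suc k dvd poly m (s k)" "\<And>k l. k \<le> l \<Longrightarrow> p ^ Suc k dvd s l - s k"
proof -
  have "\<exists>s. \<forall>k. (p ^ Suc k dvd poly m (s k) \<and> p dvd s k - r) \<and> p ^ Suc k dvd s (Suc k) - s k"
  proof (rule dependent_nat_choice)
    show "\<exists>x. p ^ Suc 0 dvd poly m x \<and> p dvd x - r"
      using assms(2) by (intro exI[of _ r]) auto
  next
    fix x k assume x: "p ^ Suc k dvd poly m x \<and> p dvd x - r"
    then obtain y where y: "p ^ Suc k dvd y - x" "p ^ Suc (Suc k) dvd poly m y"
      using hensel_step[OF _ assms(3,1)] by blast
    have "p dvd y - x" using y(1) by (rule dvd_trans[rotated]) simp
    then have "p dvd y - r" using x dvd_add[of p "y - x" "x - r"] by simp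
    with y show "\<exists>y. (p ^ Suc (Suc k) dvd poly m y \<and> p dvd y - r) \<and> p ^ Suc k dvd y - x"
      by blast
  qed
  then obtain s where s: "\<And>k. p ^ Suc k dvd poly m (s k)" "\<And>k. p ^ Suc k dvd s (Suc k) - s k"
    by blast
  have "p ^ Suc k dvd s l - s k" if "k \<le> l" for k l
    using that
  proof (induction l rule: dec_induct)
    case (step l)
    have "p ^ Suc k dvd s (Suc l) - s l"
      using s(2)[of l] by (rule dvd_trans[rotated]) (use step.hyps in \<open>intro le_imp_power_dvd; simp\<close>)
    then show ?case using step.IH dvd_add[of _ "s (Suc l) - s l" "s l - s k"] by fastforce
  qed simp
  with s show thesis using that by blast
qed

text \<open>A place of \<open>F\<close> with residue field of prime order: \<open>R x n\<close> says that \<open>x\<close> is integral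
  at the place and has the same residue as the integer \<open>n\<close>.\<close>

locale degree_one_place =
  fixes p :: int and F :: "'c::field_char_0 set" and R :: "'c \<Rightarrow> int \<Rightarrow> bool"
  assumes prime: "prime p"
    and R_of_int: "R (of_int n) n"
    and R_add: "R x a \<Longrightarrow> R y b \<Longrightarrow> R (x + y) (a + b)"
    and R_mult: "R x a \<Longrightarrow> R y b \<Longrightarrow> R (x * y) (a * b)"
    and R_0: "R 0 n \<Longrightarrow> p dvd n"
    and R_total: "x \<in> F \<Longrightarrow> (\<exists>n. R x n) \<or> R (inverse x) 0"

text \<open>\<open>s\<close> is a sequence of integer approximations to a \<open>p\<close>-adic root of the minimal polynomial
  of \<open>\<theta>\<close>: the embedding of \<open>Qadj \<theta>\<close> into the \<open>p\<close>-adic numbers is available only through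
  the congruences below.\<close>

locale hensel_root =
  fixes \<theta> :: "'c::field_char_0" and p :: int and s :: "nat \<Rightarrow> int"
  assumes prime: "prime p"
    and cauchy: "k \<le> l \<Longrightarrow> p ^ Suc k dvd s l - s k"
    and root: "ipoly q \<theta> = 0 \<Longrightarrow> p ^ Suc k dvd poly q (s k)"
    and alg: "x \<in> Qadj \<theta> \<Longrightarrow> algebraic_over_Z x"
begin

text \<open>The p-adic image of \<open>x\<close> is approximated by \<open>poly q (s j)\<close>
  divided by \<open>p ^ j * N\<close>. Precision \<open>Suc j\<close> leaves exactly one digit after
  division by \<open>p ^ j\<close>, namely the residue \<open>n\<close>.\<close>

definition R :: "'c \<Rightarrow> int \<Rightarrow> bool" where
  "R x n \<longleftrightarrow> (\<exists>j N q. \<not> p dvd N \<and> of_int (p ^ j * N) * x = ipoly q \<theta> \<and>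
     p ^ Suc j dvd poly q (s j) - p ^ j * N * n)"

lemma poly_cauchy: "k \<le> l \<Longrightarrow> p ^ Suc k dvd poly q (s l) - poly q (s k)"
  using cauchy poly_diff_dvd_int dvd_trans by blast

lemma poly_cauchy_iff:
  assumes "k \<le> l" shows "p ^ Suc k dvd poly q (s l) - c \<longleftrightarrow> p ^ Suc k dvd poly q (s k) - c"
  using dvd_add_right_iff[OF poly_cauchy[OF assms, of q], of "poly q (s k) - c"] by simp

text \<open>The congruence persists at all later indices, so two representations with exponents
  \<open>j\<close> and \<open>k\<close> can be combined at the index \<open>j + k\<close>.\<close>

lemma RE:
  assumes "R x n" 
  obtains j N q where "\<not> p dvd N" "of_int (p ^ j * N) * x = ipoly q \<theta>"
     "\<And>l. j \<le> l \<Longrightarrow> p ^ Suc j dvd poly q (s l) - p ^ j * N * n"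
  using assms unfolding R_def using poly_cauchy_iff by blast

lemma RI: "\<not> p dvd N \<Longrightarrow> of_int (p ^ j * N) * x = ipoly q \<theta> \<Longrightarrow>
   p ^ Suc j dvd poly q (s j) - p ^ j * N * n \<Longrightarrow> R x n"
  unfolding R_def by blast

lemma R_add:
  assumes "R x a" "R y b" shows "R (x + y) (a + b)"
proof -
  obtain j N q where 1: "\<not> p dvd N" "of_int (p ^ j * N) * x = ipoly q \<theta>"
     "\<And>l. j \<le> l \<Longrightarrow> p ^ Suc j dvd poly q (s l) - p ^ j * N * a" using RE[OF assms(1)] by metis
  obtain k M r where 2: "\<not> p dvd M" "of_int (p ^ k * M) * y = ipoly r \<theta>"
     "\<And>l. k \<le> l \<Longrightarrow> p ^ Suc k dvd poly r (s l) - p ^ k * M * b" using RE[OF assms(2)] by metis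
  show ?thesis
  proof (rule RI)
    show "\<not> p dvd N * M" using 1 2 prime by (simp add: prime_dvd_mult_iff)
    show "of_int (p ^ (j + k) * (N * M)) * (x + y) = ipoly (smult (p ^ k * M) q + smult (p ^ j * N) r) \<theta>"
      by (simp add: algebra_simps power_add flip: 1(2) 2(2))
    define S T where "S = poly q (s (j + k))" and "T = poly r (s (j + k))"
    have "p ^ Suc j * p ^ k dvd (S - p ^ j * N * a) * (p ^ k * M)"
      unfolding S_def by (intro mult_dvd_mono 1(3)) auto
    moreover have "p ^ Suc k * p ^ j dvd (T - p ^ k * M * b) * (p ^ j * N)"
      unfolding T_def by (intro mult_dvd_mono 2(3)) auto
    moreover have "p ^ Suc j * p ^ k = p ^ Suc (j + k)" "p ^ Suc k * p ^ j = p ^ Suc (j + k)"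
      by (simp_all add: power_add)
    ultimately have "p ^ Suc (j + k) dvd (S - p ^ j * N * a) * (p ^ k * M) + (T - p ^ k * M * b) * (p ^ j * N)"
      by (metis dvd_add)
    also have "\<dots> = poly (smult (p ^ k * M) q + smult (p ^ j * N) r) (s (j + k)) -
        p ^ (j + k) * (N * M) * (a + b)"
      by (simp add: S_def T_def algebra_simps power_add)
    finally show "p ^ Suc (j + k) dvd poly (smult (p ^ k * M) q + smult (p ^ j * N) r) (s (j + k)) -
        p ^ (j + k) * (N * M) * (a + b)" .
  qed
qed

lemma R_mult:
  assumes "R x a" "R y b" shows "R (x * y) (a * b)"
proof -
  obtain j N q where 1: "\<not> p dvd N" "of_int (p ^ j * N) * x = ipoly q \<theta>"
     "\<And>l. j \<le> l \<Longrightarrow> p ^ Suc j dvd poly q (s l) - p ^ j * N * a" using RE[OF assms(1)] by metis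
  obtain k M r where 2: "\<not> p dvd M" "of_int (p ^ k * M) * y = ipoly r \<theta>"
     "\<And>l. k \<le> l \<Longrightarrow> p ^ Suc k dvd poly r (s l) - p ^ k * M * b" using RE[OF assms(2)] by metis
  show ?thesis
  proof (rule RI)
    show "\<not> p dvd N * M" using 1 2 prime by (simp add: prime_dvd_mult_iff)
    show "of_int (p ^ (j + k) * (N * M)) * (x * y) = ipoly (q * r) \<theta>"
      by (simp add: power_add flip: 1(2) 2(2))
    define S T where "S = poly q (s (j + k))" and "T = poly r (s (j + k))"
    have ST: "p ^ Suc j dvd S - p ^ j * N * a" "p ^ Suc k dvd T - p ^ k * M * b"
      using 1(3) 2(3) by (simp_all add: S_def T_def)
    \<comment> \<open>\<open>T\<close> is itself divisible by \<open>p ^ k\<close>, which supplies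
      the missing factor when \<open>S - p ^ j * N * a\<close> is multiplied by
      \<open>T\<close>.\<close>
    have "p ^ k dvd T - p ^ k * M * b" using ST(2) by (rule dvd_trans[rotated]) simp
    then have "p ^ k dvd T" by (metis dvd_diffD1 dvd_triv_left mult.assoc zdvd_zdiffD)
    then have "p ^ Suc j * p ^ k dvd (S - p ^ j * N * a) * T"
      using ST by (intro mult_dvd_mono)
    moreover have "p ^ Suc k * p ^ j dvd (T - p ^ k * M * b) * (p ^ j * (N * a))"
      using ST by (intro mult_dvd_mono) auto
    moreover have "p ^ Suc j * p ^ k = p ^ Suc (j + k)" "p ^ Suc k * p ^ j = p ^ Suc (j + k)"
      by (simp_all add: power_add)
    ultimately have "p ^ Suc (j + k) dvd (S - p ^ j * N * a) * T + (T - p ^ k * M * b) * (p ^ j * (N * a))"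
      by (metis dvd_add)
    also have "\<dots> = S * T - p ^ (j + k) * (N * M) * (a * b)"
      by (simp add: algebra_simps power_add)
    finally have "p ^ Suc (j + k) dvd S * T - p ^ (j + k) * (N * M) * (a * b)" .
    then show "p ^ Suc (j + k) dvd poly (q * r) (s (j + k)) - p ^ (j + k) * (N * M) * (a * b)"
      by (simp add: S_def T_def)
  qed
qed

lemma R_0: assumes "R 0 n" shows "p dvd n"
proof -
  obtain j N q where 1: "\<not> p dvd N" "of_int (p ^ j * N) * 0 = ipoly q \<theta>"
     "\<And>l. j \<le> l \<Longrightarrow> p ^ Suc j dvd poly q (s l) - p ^ j * N * n" using RE[OF assms] by metis
  have "p ^ Suc j dvd poly q (s j)" using 1(2) by (intro root) simp
  with 1(3)[of j] have "p ^ Suc j dvd p ^ j * (N * n)" by (metis dvd_diffD1 dvd_diff_commute mult.assoc order_refl zdvd_zdiffD)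
  then have "p dvd N * n" using prime by (simp add: mult.commute[of p])
  then show ?thesis using 1(1) prime by (simp add: prime_dvd_mult_iff)
qed

text \<open>The case of nonnegative valuation: the residue is the quotient \<open>b\<close> of
  \<open>poly q (s j)\<close> by \<open>p ^ j\<close>, divided by \<open>N\<close> modulo
  \<open>p\<close>.\<close>

lemma R_exists:
  assumes "\<not> p dvd N" "of_int (p ^ j * N) * x = ipoly q \<theta>" "p ^ j dvd poly q (s j)"
  shows "\<exists>n. R x n"
proof -
  obtain b where b: "poly q (s j) = p ^ j * b" using assms(3) by (auto simp: dvd_def)
  have "coprime N p" using assms(1) prime by (metis coprime_commute prime_imp_coprime)
  then obtain v where v: "[N * v = 1] (mod p)" using cong_solve_coprime_int by blast
  then have "p dvd 1 - N * v" by (metis cong_iff_dvd_diff dvd_diff_commute)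
  then have "p ^ j * p dvd p ^ j * (b * (1 - N * v))" by (intro mult_dvd_mono) auto
  then have "p ^ Suc j dvd poly q (s j) - p ^ j * N * (b * v)"
    unfolding b by (simp add: algebra_simps)
  then show ?thesis using RI assms(1,2) by blast
qed

text \<open>The case of negative valuation. With \<open>t\<close> inverting \<open>q\<close> at
  \<theta> up to \<open>c\<close>, the inverse of \<open>x\<close> is \<open>p ^ j * N\<close> times
  \<open>ipoly t \<theta>\<close> over \<open>c\<close>, and the valuation of \<open>Q\<close> being
  less than \<open>j\<close> makes this divisible by \<open>p\<close>.\<close>

lemma R_inverse:
  assumes "\<not> p dvd N" "of_int (p ^ j * N) * x = ipoly q \<theta>" "\<not> p ^ j dvd poly q (s j)"
  shows "R (inverse x) 0"
proof -
  have "ipoly q \<theta> \<noteq> 0"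
  proof
    assume "ipoly q \<theta> = 0"
    then have "p ^ Suc j dvd poly q (s j)" by (rule root)
    then have "p ^ j dvd poly q (s j)" by (rule dvd_trans[rotated]) simp
    with assms(3) show False by blast
  qed
  moreover have "ipoly q \<theta> \<in> Qadj \<theta>" by (rule QadjI[of 1]) auto
  ultimately obtain c t where c: "c \<noteq> 0" "ipoly t \<theta> * ipoly q \<theta> = of_int c"
    using ipoly_inverse_witness alg by metis
  obtain l c' where l: "c = p ^ l * c'" "\<not> p dvd c'"
    using multiplicity_decompose'[of c p] c(1) prime by (metis not_prime_unit)
  define Q T where "Q = poly q (s (j + l))" and "T = poly t (s (j + l))"
  have j: "j > 0" using assms(3) by (cases j) auto
  \<comment> \<open>Divisibility by \<open>p ^ j\<close> is settled from index \<open>j - 1\<close>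
    on, so it can be read off at \<open>j + l\<close>, where the relation for
    \<open>t * q - [:c:]\<close> is precise enough.\<close>
  have "p ^ Suc (j - 1) dvd poly q (s (j + l)) - 0 \<longleftrightarrow> p ^ Suc (j - 1) dvd poly q (s j) - 0"
    using poly_cauchy_iff[of "j - 1" j q 0] poly_cauchy_iff[of "j - 1" "j + l" q 0] by auto
  then have nQ: "\<not> p ^ j dvd Q" using assms(3) j by (simp add: Q_def)
  have "Q \<noteq> 0" using nQ by auto
  then obtain i Q' where i: "Q = p ^ i * Q'" "\<not> p dvd Q'"
    using multiplicity_decompose'[of Q p] prime by (metis not_prime_unit)
  have "i < j" using nQ i by (metis dvd_mult2 le_imp_power_dvd not_less)
  have "p ^ Suc (j + l) dvd poly (t * q - [:c:]) (s (j + l))"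
    using c by (intro root) simp
  then have "p ^ Suc (j + l) dvd T * Q - c" by (simp add: Q_def T_def)
  then have "p ^ l dvd T * Q - c" by (rule dvd_trans[rotated]) (intro le_imp_power_dvd, simp)
  then have "p ^ l dvd T * Q" using l by (metis dvd_triv_left zdvd_zdiffD)
  then have "p ^ l dvd (T * p ^ i) * Q'" by (simp add: i algebra_simps)
  moreover have "coprime (p ^ l) Q'"
    using i prime by (simp add: prime_imp_coprime)
  ultimately have "p ^ l dvd T * p ^ i" by (simp add: coprime_dvd_mult_left_iff)
  \<comment> \<open>The strict inequality \<open>i < j\<close> gains one more factor
    \<open>p\<close>; hence the residue of the inverse is 0.\<close>
  then have "p ^ l * p dvd T * p ^ i * p" by (intro mult_dvd_mono) auto
  also have "T * p ^ i * p = T * p ^ Suc i" by simp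
  also have "\<dots> dvd T * p ^ j" using \<open>i < j\<close> by (intro mult_dvd_mono le_imp_power_dvd) auto
  finally have "p ^ Suc l dvd poly (smult (p ^ j * N) t) (s (j + l)) - 0"
    by (auto simp: T_def algebra_simps)
  then have *: "p ^ Suc l dvd poly (smult (p ^ j * N) t) (s l) - 0"
    using poly_cauchy_iff[of l "j + l" "smult (p ^ j * N) t" 0] by linarith
  show ?thesis
  proof (rule RI)
    show "\<not> p dvd c'" by fact
    show "of_int (p ^ l * c') * inverse x = ipoly (smult (p ^ j * N) t) \<theta>"
    proof -
      have "x \<noteq> 0" using assms(2) \<open>ipoly q \<theta> \<noteq> 0\<close> by auto
      then show ?thesis unfolding l(1)[symmetric] c(2)[symmetric] assms(2)[symmetric] by simp
    qed
  qed (use * in simp)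
qed

sublocale degree_one_place p "Qadj \<theta>" R
proof
  show "Factorial_Ring.prime p" by (rule prime)
  show "R (of_int n) n" for n
    by (rule RI[of 1 0 _ "[:n:]"]) (use prime not_prime_unit in auto)
  show "(\<exists>n. R x n) \<or> R (inverse x) 0" if x: "x \<in> Qadj \<theta>" for x
  proof -
    from x obtain N q where 1: "N \<noteq> 0" "of_int N * x = ipoly q \<theta>" by (rule QadjE)
    obtain j N' where "N = p ^ j * N'" "\<not> p dvd N'"
      using multiplicity_decompose'[of N p] 1(1) prime by (metis not_prime_unit)
    then show ?thesis using R_exists R_inverse 1(2) by metis
  qed
qed (use R_add R_mult R_0 in auto)

end

text \<open>A prime dividing a value of the minimal polynomial yields a root modulo
  \<open>p\<close>. Finitely many primes are avoided: those of the leading coefficient, those of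
  \<open>c\<close>, which would allow a multiple root, and those in the denominators of
  \<open>S\<close>.\<close>

lemma degree_one_place_exists:
  fixes \<theta> :: "'c::field_char_0"
  assumes alg: "\<And>x. x \<in> Qadj \<theta> \<Longrightarrow> algebraic_over_Z x"
    and S: "finite S" "S \<subseteq> Qadj \<theta>"
  obtains p R where "degree_one_place p (Qadj \<theta>) R" "\<And>x. x \<in> S \<Longrightarrow> \<exists>n. R x n"
proof -
  have "algebraic_over_Z \<theta>" by (rule alg) simp
  then obtain m where m: "m \<noteq> 0" "ipoly m \<theta> = 0"
    "\<And>q. q \<noteq> 0 \<Longrightarrow> ipoly q \<theta> = 0 \<Longrightarrow> degree m \<le> degree q" using minimal_ipoly by blast
  have deg: "degree m > 0"
  proof (rule ccontr)
    assume "\<not> degree m > 0"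
    then obtain a where "m = [:a:]" by (metis degree_eq_zeroE neq0_conv)
    with m show False by simp
  qed
  then have "pderiv m \<noteq> 0" "degree (pderiv m) < degree m" by (auto simp: pderiv_eq_0_iff degree_pderiv)
  with m(3)[of "pderiv m"] have "ipoly (pderiv m) \<theta> \<noteq> 0" by fastforce
  moreover have "ipoly (pderiv m) \<theta> \<in> Qadj \<theta>" by (rule QadjI[of 1]) auto
  ultimately obtain c w where c: "c \<noteq> 0" "ipoly w \<theta> * ipoly (pderiv m) \<theta> = of_int c"
    using ipoly_inverse_witness alg by metis
  have "\<forall>x\<in>S. \<exists>N q. N \<noteq> 0 \<and> of_int N * x = ipoly q \<theta>" using S(2) by (auto simp: Qadj_def)
  then obtain N q where N: "\<And>x. x \<in> S \<Longrightarrow> N x \<noteq> 0" "\<And>x. x \<in> S \<Longrightarrow> of_int (N x) * x = ipoly (q x) \<theta>"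
    by metis
  have "lead_coeff m * c * prod N S \<noteq> 0" using m(1) c(1) N(1) S(1) by auto
  then obtain p r where p: "prime p" "\<not> p dvd lead_coeff m * c * prod N S" "p dvd poly m r"
    using prime_divisor_of_values[OF deg] by blast
  then have nd: "\<not> p dvd lead_coeff m" "\<not> p dvd c" "\<not> p dvd prod N S" by auto
  \<comment> \<open>Every relation satisfied by \<theta> holds at \<open>r\<close> to the same
    p-adic precision as \<open>m\<close> does.\<close>
  have root: "p ^ k dvd poly q r" if dvd: "p ^ k dvd poly m r" and zero: "ipoly q \<theta> = 0" for q k r
  proof -
    obtain n where "m dvd smult (lead_coeff m ^ n) q" using minimal_ipoly_dvd[OF m zero] by blast
    then have "poly m r dvd lead_coeff m ^ n * poly q r" by (metis dvd_def poly_mult poly_smult)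
    then have "p ^ k dvd lead_coeff m ^ n * poly q r" using dvd dvd_trans by blast
    moreover have "coprime (p ^ k) (lead_coeff m ^ n)" using nd p(1) by (simp add: prime_imp_coprime)
    ultimately show ?thesis by (simp add: coprime_dvd_mult_right_iff)
  qed
  \<comment> \<open>The identity defining \<open>c\<close> reduces modulo \<open>p\<close>, so the
    derivative at \<open>r\<close> divides a unit and \<open>r\<close> is a simple root.\<close>
  have "p dvd poly (w * pderiv m - [:c:]) r" using root[where k = 1 and q = "w * pderiv m - [:c:]"] p(3) c(2) by simp
  then have "p dvd poly w r * poly (pderiv m) r - c" by simp
  then have "\<not> p dvd poly (pderiv m) r" using nd(2) by (metis dvd_mult zdvd_zdiffD dvd_diff_commute)
  then obtain s where s: "\<And>k. p ^ Suc k dvd poly m (s k)" "\<And>k l. k \<le> l \<Longrightarrow> p ^ Suc k dvd s l - s k"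
    using hensel_sequence[OF p(1,3)] by metis
  interpret hensel_root \<theta> p s
    using p(1) s root alg by unfold_locales blast+
  show thesis
  proof (rule that)
    show "degree_one_place p (Qadj \<theta>) R" by (rule degree_one_place_axioms)
    fix x assume x: "x \<in> S"
    have "\<not> p dvd N x" using nd(3) x S(1) by (meson dvd_prod_eqI dvd_trans dvd_prodI)
    then show "\<exists>n. R x n" using N(2)[OF x] by (intro R_exists[of "N x" 0 _ "q x"]) auto
  qed
qed

section \<open>Values missed modulo a prime\<close>

text \<open>Pigeonhole: each unit \<open>y\<close> modulo \<open>p\<close> excludes one residue
  \<open>a\<close>, and there are only \<open>p - 1\<close> units for \<open>p\<close>
  residues.\<close>

lemma missed_value_off_zero:
  fixes s :: "int poly"
  assumes "prime p"
  obtains a where "a > 0" "\<And>y. \<not> p dvd y \<Longrightarrow> \<not> p dvd poly s y + a * y ^ i"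
proof -
  have p: "p > 1" using assms by (rule prime_gt_1_int)
  have "\<exists>a\<in>{0..<p}. \<forall>y. \<not> p dvd y \<longrightarrow> \<not> p dvd poly s y + a * y ^ i"
  proof (rule ccontr)
    assume "\<not> ?thesis"
    then obtain y where y: "\<And>a. a \<in> {0..<p} \<Longrightarrow> \<not> p dvd y a \<and> p dvd poly s (y a) + a * y a ^ i"
      by metis
    have "inj_on (\<lambda>a. y a mod p) {0..<p}"
    proof (rule inj_onI)
      fix a b assume ab: "a \<in> {0..<p}" "b \<in> {0..<p}" "y a mod p = y b mod p"
      have "poly s (y a) mod p = poly s (y b) mod p"
        using ab(3) poly_diff_dvd_int[of "y a" "y b" s] by (meson dvd_trans mod_eq_dvd_iff)
      moreover have "b * y a ^ i mod p = b * y b ^ i mod p"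
        using ab(3) by (metis mod_mult_right_eq power_mod)
      ultimately have "p dvd poly s (y a) + b * y a ^ i"
        using y[OF ab(2)] by (metis mod_add_cong dvd_eq_mod_eq_0)
      then have "p dvd (poly s (y a) + a * y a ^ i) - (poly s (y a) + b * y a ^ i)"
        using y[OF ab(1)] by (intro dvd_diff) auto
      then have "p dvd (a - b) * y a ^ i" by (simp add: algebra_simps)
      then have "p dvd a - b"
        using y[OF ab(1)] assms by (metis prime_dvd_mult_iff prime_dvd_power)
      then have "a mod p = b mod p" by (simp add: mod_eq_dvd_iff)
      then show "a = b" using ab by simp
    qed
    moreover have "(\<lambda>a. y a mod p) ` {0..<p} \<subseteq> {1..<p}"
    proof clarify
      fix a assume "a \<in> {0..<p}"
      then have "y a mod p \<noteq> 0" using y by auto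
      moreover have "0 \<le> y a mod p" "y a mod p < p" using p by auto
      ultimately show "y a mod p \<in> {1..<p}" by simp
    qed
    ultimately have "card {0..<p} \<le> card {1..<p}" by (rule card_inj_on_le) simp
    then show False using p by simp
  qed
  then obtain a where a: "a \<in> {0..<p}" "\<And>y. \<not> p dvd y \<Longrightarrow> \<not> p dvd poly s y + a * y ^ i" by blast
  \<comment> \<open>Adding \<open>p\<close> keeps the residue and makes the value positive, hence
    nonzero in characteristic 0.\<close>
  have "\<not> p dvd poly s y + (a + p) * y ^ i" if "\<not> p dvd y" for y
  proof -
    have "poly s y + (a + p) * y ^ i = (poly s y + a * y ^ i) + p * y ^ i" by (simp add: algebra_simps)
    then show ?thesis using a(2)[OF that] by (simp only: dvd_add_left_iff dvd_triv_left simp_thms)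
  qed
  with a p show thesis by (intro that[of "a + p"]) auto
qed

text \<open>A self-map of a finite set that is not injective is not surjective either.\<close>

lemma missed_value_noninjective:
  fixes s :: "int poly"
  assumes p: "p > 1" and uv: "\<not> p dvd u - v" "p dvd poly s u - poly s v"
  obtains a where "a > 0" "\<And>y. \<not> p dvd poly s y + a"
proof -
  have sm: "p dvd poly s x - poly s (x mod p)" for x
    using poly_diff_dvd_int[of x "x mod p" s] by (meson dvd_minus_mod dvd_trans)
  \<comment> \<open>\<open>f y\<close> is the only residue whose addition makes \<open>y\<close> a
    root modulo \<open>p\<close>.\<close>
  define f where "f y = (- poly s y) mod p" for y
  have "\<not> inj_on f {0..<p}"
  proof
    assume "inj_on f {0..<p}"
    moreover have "f (u mod p) = f (v mod p)"
    proof -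
      have "f (x mod p) = f x" for x
        using sm[of x] unfolding f_def mod_eq_dvd_iff by (simp add: dvd_diff_commute algebra_simps)
      moreover have "f u = f v"
        using uv(2) unfolding f_def mod_eq_dvd_iff by (simp add: dvd_diff_commute algebra_simps)
      ultimately show ?thesis by simp
    qed
    ultimately have "u mod p = v mod p" using p by (auto dest: inj_onD)
    then show False using uv(1) by (simp add: mod_eq_dvd_iff)
  qed
  then have "\<not> {0..<p} \<subseteq> f ` {0..<p}" using finite_surj_inj[of "{0..<p}" f] by auto
  then obtain a where a: "a \<in> {0..<p}" "a \<notin> f ` {0..<p}" by blast
  have "\<not> p dvd poly s y + (a + p)" for y
  proof
    assume "p dvd poly s y + (a + p)"
    then have "p dvd poly s y + a" by (simp flip: add.assoc)
    then have "p dvd (poly s y + a) - (poly s y - poly s (y mod p))"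
      using sm by (rule dvd_diff)
    then have "p dvd - poly s (y mod p) - a" by (metis add.commute add_diff_cancel_left diff_diff_eq2 dvd_minus_iff minus_add_distrib uminus_add_conv_diff minus_diff_eq)
    then have "f (y mod p) = a mod p" by (simp add: f_def mod_eq_dvd_iff)
    moreover have "a mod p = a" "y mod p \<in> {0..<p}" using a(1) p by auto
    ultimately show False using a(2) by (metis image_eqI)
  qed
  with a p show thesis by (intro that[of "a + p"]) auto
qed

section \<open>Reduction of polynomials at a place of degree one\<close>

context degree_one_place
begin

lemma R_unique:
  assumes "R x a" "R x b" shows "p dvd a - b"
proof -
  have "R (x + of_int (- 1) * x) (a + (- 1) * b)" by (intro R_add R_mult R_of_int assms)
  then show ?thesis using R_0 by simp
qed

lemma R_unit:
  assumes "R x a" "R (inverse x) b" "x \<noteq> 0" shows "\<not> p dvd a"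
proof
  assume "p dvd a"
  have "R 1 (a * b)" using R_mult[OF assms(1,2)] assms(3) by simp
  then have "p dvd a * b - 1" using R_unique R_of_int[of 1] by simp
  with \<open>p dvd a\<close> have "p dvd 1" by (metis dvd_mult2 zdvd_zdiffD dvd_diff_commute)
  then show False using prime not_prime_unit by blast
qed

lemma R_poly:
  assumes "\<And>j. R (coeff f j) (coeff s j)" "R x y"
  shows "R (poly f x) (poly s y)"
  using assms(1)
proof (induction f s rule: poly_induct2)
  case 0 show ?case using R_of_int[of 0] by simp
next
  case (pCons a f b s)
  have "R a b" using pCons.prems[of 0] by simp
  moreover have "R (coeff f j) (coeff s j)" for j using pCons.prems[of "Suc j"] by simp
  ultimately show ?case using pCons.IH assms(2) by (simp add: R_add R_mult)
qed

lemma reduce_poly: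
  assumes "\<And>j. \<exists>n. R (coeff f j) n"
  obtains s where "\<And>j. R (coeff f j) (coeff s j)"
proof -
  from assms have "\<exists>s. \<forall>j. R (coeff f j) (coeff s j)"
  proof (induction f)
    case 0 show ?case using R_of_int[of 0] by (intro exI[of _ 0]) simp
  next
    case (pCons a f)
    obtain n where n: "R a n" using pCons.prems[of 0] by auto
    have "\<exists>n. R (coeff f j) n" for j using pCons.prems[of "Suc j"] by simp
    then obtain s where "\<forall>j. R (coeff f j) (coeff s j)" using pCons.IH by blast
    with n have "R (coeff (pCons a f) j) (coeff (pCons n s) j)" for j by (cases j) auto
    then show ?case by blast
  qed
  then show thesis using that by blast
qed

text \<open>If \<open>x\<close> were not integral, its inverse would have residue 0. The reversed
  polynomial at this inverse would then force the leading coefficient, a unit, to have residue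
  0.\<close>

lemma root_integral:
  assumes "\<And>j. \<exists>n. R (coeff f j) n" "\<exists>n. R (inverse (lead_coeff f)) n" "f \<noteq> 0" "x \<in> F" "poly f x = 0"
  shows "\<exists>y. R x y"
proof (rule ccontr)
  assume nx: "\<nexists>y. R x y"
  then have "x \<noteq> 0" using R_of_int[of 0] by auto
  have Rx: "R (inverse x) 0" using nx R_total assms(4) by blast
  have "\<exists>n. R (coeff (reflect_poly f) j) n" for j
    using assms(1) R_of_int[of 0] by (auto simp: coeff_reflect_poly)
  then obtain s where s: "\<And>j. R (coeff (reflect_poly f) j) (coeff s j)" using reduce_poly by blast
  have "R (poly (reflect_poly f) (inverse x)) (poly s 0)" by (rule R_poly[OF s Rx])
  moreover have "poly (reflect_poly f) (inverse x) = 0"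
    using \<open>x \<noteq> 0\<close> assms(5) by (simp add: poly_reflect_poly_nz)
  ultimately have "p dvd coeff s 0" using R_0 by (simp add: poly_0_coeff_0)
  moreover have "R (lead_coeff f) (coeff s 0)" using s[of 0] by simp
  ultimately show False using assms(2,3) R_unit by fastforce
qed

end

section \<open>Integer coefficients that avoid roots in a simple extension\<close>

text \<open>At a place where the two end coefficients of \<open>g\<close> are units, every root is
  integral with nonzero residue, so the value from \<open>missed_value_off_zero\<close> excludes
  it.\<close>

lemma integer_coeff_avoiding_roots_middle:
  assumes alg: "\<And>x. x \<in> Qadj \<theta> \<Longrightarrow> algebraic_over_Z x"
    and g: "\<And>j. coeff g j \<in> Qadj \<theta>" "coeff g 0 \<noteq> 0" and i: "0 < i" "i < degree g"
  obtains a where "a > 0" "\<And>x. x \<in> Qadj \<theta> \<Longrightarrow> poly (g + monom (of_int a) i) x \<noteq> 0"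
proof -
  define S where "S = range (coeff g) \<union> {inverse (lead_coeff g), inverse (coeff g 0)}"
  have "finite S" unfolding S_def range_coeff by simp
  moreover have "S \<subseteq> Qadj \<theta>" using g Qadj_inverse[OF _ alg] by (auto simp: S_def)
  ultimately obtain p R where "degree_one_place p (Qadj \<theta>) R" and S: "\<And>x. x \<in> S \<Longrightarrow> \<exists>n. R x n"
    using degree_one_place_exists[OF alg] by metis
  then interpret degree_one_place p "Qadj \<theta>" R by simp
  have "\<exists>n. R (coeff g j) n" for j using S by (auto simp: S_def)
  then obtain s where s: "\<And>j. R (coeff g j) (coeff s j)" using reduce_poly by blast
  obtain a where a: "a > 0" "\<And>y. \<not> p dvd y \<Longrightarrow> \<not> p dvd poly s y + a * y ^ i"
    using missed_value_off_zero[OF prime] by metis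
  define f where "f = g + monom (of_int a) i"
  have "poly f x \<noteq> 0" if x: "x \<in> Qadj \<theta>" for x
  proof
    assume 0: "poly f x = 0"
    have f: "R (coeff f j) (coeff (s + monom a i) j)" for j
      using R_add[OF s[of j] R_of_int[of "if j = i then a else 0"]] by (auto simp: f_def)
    have deg: "degree f = degree g"
      unfolding f_def by (rule degree_add_eq_left) (metis degree_monom_le i(2) le_less_trans)
    then have lead: "lead_coeff f = lead_coeff g" using i by (simp add: f_def)
    have "f \<noteq> 0" using deg i by auto
    then obtain y where y: "R x y"
      using root_integral[of f x] f lead S x 0 by (fastforce simp: S_def)
    have "p dvd poly (s + monom a i) y" using R_poly[OF f y] 0 R_0 by simp
    then have *: "p dvd poly s y + a * y ^ i" by (simp add: poly_monom)
    \<comment> \<open>A root with residue 0 would make the constant coefficient vanish modulo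
      \<open>p\<close>, against its being a unit.\<close>
    with a(2) have "p dvd y" by blast
    then have "p dvd poly s y - poly s 0" using poly_diff_dvd_int[of y 0 s] dvd_trans by simp
    moreover have "p dvd a * y ^ i" using i
      by (intro dvd_mult dvd_trans[OF \<open>p dvd y\<close>] dvd_power) simp
    ultimately have "p dvd poly s 0" using * by (metis dvd_add_left_iff dvd_diff_commute zdvd_zdiffD)
    then have "p dvd coeff s 0" by (simp add: poly_0_coeff_0)
    moreover obtain n where "R (inverse (coeff g 0)) n" using S by (auto simp: S_def)
    ultimately show False using R_unit[OF s[of 0]] g(2) by blast
  qed
  with a(1) show thesis using that by (simp add: f_def)
qed

text \<open>Making \<open>z - w\<close> a unit at the place keeps the collision of \<open>z\<close>
  and \<open>w\<close> under \<open>g\<close> visible modulo \<open>p\<close>, as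
  \<open>missed_value_noninjective\<close> requires.\<close>

lemma integer_coeff_avoiding_roots_constant:
  assumes alg: "\<And>x. x \<in> Qadj \<theta> \<Longrightarrow> algebraic_over_Z x"
    and g: "\<And>j. coeff g j \<in> Qadj \<theta>" "degree g > 0"
    and zw: "z \<in> Qadj \<theta>" "w \<in> Qadj \<theta>" "z \<noteq> w" "poly g z = poly g w"
  obtains a where "a > 0" "\<And>x. x \<in> Qadj \<theta> \<Longrightarrow> poly (g + [:of_int a:]) x \<noteq> 0"
proof -
  define S where "S = range (coeff g) \<union> {inverse (lead_coeff g), z, w, inverse (z - w)}"
  have "finite S" unfolding S_def range_coeff by simp
  moreover have "S \<subseteq> Qadj \<theta>" using g zw Qadj_inverse[OF _ alg] Qadj_inverse[OF Qadj_diff[OF zw(1,2)] alg]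
    by (auto simp: S_def)
  ultimately obtain p R where "degree_one_place p (Qadj \<theta>) R" and S: "\<And>x. x \<in> S \<Longrightarrow> \<exists>n. R x n"
    using degree_one_place_exists[OF alg] by metis
  then interpret degree_one_place p "Qadj \<theta>" R by simp
  have "\<exists>n. R (coeff g j) n" for j using S by (auto simp: S_def)
  then obtain s where s: "\<And>j. R (coeff g j) (coeff s j)" using reduce_poly by blast
  obtain u v n where uv: "R z u" "R w v" "R (inverse (z - w)) n"
    using S[of z] S[of w] S[of "inverse (z - w)"] by (auto simp: S_def)
  have "R (z + of_int (- 1) * w) (u + (- 1) * v)" by (intro R_add R_mult R_of_int uv)
  then have "\<not> p dvd u - v" using R_unit[OF _ uv(3)] zw(3) by simp
  moreover have "p dvd poly s u - poly s v"
    using R_unique[OF R_poly[OF s uv(1)]] R_poly[OF s uv(2)] zw(4) by simp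
  ultimately obtain a where a: "a > 0" "\<And>y. \<not> p dvd poly s y + a"
    using missed_value_noninjective[OF prime_gt_1_int[OF prime]] by metis
  define f where "f = g + [:of_int a:]"
  have "poly f x \<noteq> 0" if x: "x \<in> Qadj \<theta>" for x
  proof
    assume 0: "poly f x = 0"
    have f: "R (coeff f j) (coeff (s + [:a:]) j)" for j
      using R_add[OF s[of j] R_of_int[of "if j = 0 then a else 0"]] by (auto simp: f_def coeff_pCons split: nat.splits)
    have deg: "degree f = degree g"
      unfolding f_def by (rule degree_add_eq_left) (use g in simp)
    then have lead: "lead_coeff f = lead_coeff g" using g by (simp add: f_def coeff_pCons split: nat.splits)
    have "f \<noteq> 0" using deg g by auto
    then obtain y where y: "R x y"
      using root_integral[of f x] f lead S x 0 by (fastforce simp: S_def)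
    have "p dvd poly (s + [:a:]) y" using R_poly[OF f y] 0 R_0 by simp
    then show False using a(2) by simp
  qed
  with a(1) show thesis using that by (simp add: f_def)
qed

section \<open>The primitive element theorem\<close>

interpretation rat_vs: vector_space "rat_scale :: rat \<Rightarrow> 'k \<Rightarrow> 'k::field_char_0"
  by (rule vector_space_rat_scale)

lemma ipoly_sum: "ipoly (\<Sum>i\<in>A. f i) x = (\<Sum>i\<in>A. ipoly (f i) x)"
  by (induction A rule: infinite_finite_induct) auto

section \<open>Finite-dimensional algebras over the rationals\<close>

text \<open>These are the number fields inside the ambient field, since their elements are
  algebraic. They are sets, not types, so that further elements can be adjoined.\<close>

definition finite_rat_subring :: "'c::field_char_0 set \<Rightarrow> bool" where
  "finite_rat_subring L \<longleftrightarrow> 1 \<in> L \<and> (\<forall>x\<in>L. \<forall>y\<in>L. x * y \<in> L) \<and>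
     (\<exists>B. finite B \<and> L = module.span rat_scale B)"

context
  fixes L :: "'c::field_char_0 set"
  assumes L: "finite_rat_subring L"
begin

lemma rat_subring_subspace: "rat_vs.subspace L"
  using L unfolding finite_rat_subring_def by (auto intro: rat_vs.subspace_span)

lemma rat_subring_mult: "x \<in> L \<Longrightarrow> y \<in> L \<Longrightarrow> x * y \<in> L"
  using L by (auto simp: finite_rat_subring_def)

lemma rat_subring_add: "x \<in> L \<Longrightarrow> y \<in> L \<Longrightarrow> x + y \<in> L"
  using rat_vs.subspace_add[OF rat_subring_subspace] .

lemma rat_subring_uminus: "x \<in> L \<Longrightarrow> - x \<in> L"
  using rat_vs.subspace_neg[OF rat_subring_subspace] .

lemma rat_subring_of_rat: "of_rat q \<in> L"
  using rat_vs.subspace_scale[OF rat_subring_subspace, of 1 q] L by (simp add: rat_scale_def finite_rat_subring_def)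

lemma rat_subring_of_int: "of_int a \<in> L"
  using rat_subring_of_rat[of "of_int a"] by simp

lemma rat_subring_power: "x \<in> L \<Longrightarrow> x ^ n \<in> L"
  by (induction n) (use rat_subring_mult rat_subring_of_int[of 1] in auto)

lemma rat_subring_ipoly: "x \<in> L \<Longrightarrow> ipoly q x \<in> L"
  by (induction q) (use rat_subring_mult rat_subring_add rat_subring_of_int rat_subring_of_int[of 0] in auto)

lemma Qadj_subset_rat_subring: assumes "\<theta> \<in> L" shows "Qadj \<theta> \<subseteq> L"
proof
  fix x assume "x \<in> Qadj \<theta>"
  then obtain N q where N: "N \<noteq> 0" "of_int N * x = ipoly q \<theta>" by (rule QadjE)
  moreover have "of_rat (inverse (of_int N)) = (inverse (of_int N) :: 'c)"
    by (simp add: of_rat_inverse)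
  ultimately have "x = of_rat (inverse (of_int N)) * ipoly q \<theta>"
    by (simp flip: N(2) mult.assoc)
  then show "x \<in> L" using rat_subring_mult[OF rat_subring_of_rat rat_subring_ipoly[OF assms]] by simp
qed

text \<open>The powers of \<open>x\<close> up to exponent \<open>card B\<close> are one too many to
  be independent in the span of \<open>B\<close>; a common denominator \<open>N\<close> makes the
  relation integral.\<close>

lemma rat_subring_algebraic: assumes "x \<in> L" shows "algebraic_over_Z x"
proof -
  obtain B where B: "finite B" "L = rat_vs.span B" using L by (auto simp: finite_rat_subring_def)
  show ?thesis
  proof (cases "inj_on (\<lambda>i. x ^ i) {..card B}")
    \<comment> \<open>Two equal powers give a relation at once; only distinct powers form a set
      large enough for the dimension bound.\<close>
    case False
    then obtain i j where ij: "i \<noteq> j" "x ^ i = x ^ j" by (auto simp: inj_on_def)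
    have "coeff (monom 1 i - monom 1 j :: int poly) i \<noteq> 0" using ij by simp
    then have "(monom 1 i - monom 1 j :: int poly) \<noteq> 0" by (metis coeff_0)
    moreover have "ipoly (monom 1 i - monom 1 j) x = 0"
      using ij by simp
    ultimately show ?thesis unfolding algebraic_over_Z_def by blast
  next
    case True
    let ?P = "(\<lambda>i. x ^ i) ` {..card B}"
    have "\<not> card ?P \<le> card B" using True by (simp add: card_image)
    moreover have "?P \<subseteq> rat_vs.span B" using rat_subring_power[OF assms] B(2) by auto
    ultimately have "rat_vs.dependent ?P" using rat_vs.independent_span_bound[OF B(1)] by blast
    then obtain u where u: "(\<Sum>v\<in>?P. rat_scale (u v) v) = 0" "\<exists>v\<in>?P. u v \<noteq> 0"
      using rat_vs.dependent_finite[of ?P] by auto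
    define c where "c i = u (x ^ i)" for i
    have c: "(\<Sum>i\<le>card B. of_rat (c i) * x ^ i) = 0" "\<exists>i\<le>card B. c i \<noteq> 0"
      using u True by (auto simp: sum.reindex rat_scale_def c_def)
    define N where "N = (\<Prod>i\<le>card B. snd (quotient_of (c i)))"
    have N: "N \<noteq> 0" unfolding N_def using quotient_of_denom_pos' by (auto simp: less_le)
    have "\<exists>z. of_int N * c i = of_int z" if "i \<le> card B" for i
    proof -
      have "snd (quotient_of (c i)) dvd N" unfolding N_def by (rule dvd_prodI) (use that in auto)
      then obtain k where "N = snd (quotient_of (c i)) * k" by (auto simp: dvd_def)
      moreover have "c i = of_int (fst (quotient_of (c i))) / of_int (snd (quotient_of (c i)))"
        by (metis quotient_of_div surjective_pairing)
      moreover have "snd (quotient_of (c i)) \<noteq> 0" using quotient_of_denom_pos'[of "c i"] by simp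
      ultimately have "of_int N * c i = of_int (k * fst (quotient_of (c i)))" by (simp add: field_simps)
      then show ?thesis by blast
    qed
    then obtain z where z: "\<And>i. i \<le> card B \<Longrightarrow> of_int N * c i = of_int (z i)" by metis
    define e where "e = (\<Sum>i\<le>card B. monom (z i) i)"
    have "ipoly e x = (\<Sum>i\<le>card B. ipoly (monom (z i) i) x)"
      unfolding e_def by (rule ipoly_sum)
    also have "\<dots> = (\<Sum>i\<le>card B. of_rat (of_int N * c i) * x ^ i)"
      by (intro sum.cong) (auto simp: z)
    also have "\<dots> = of_int N * (\<Sum>i\<le>card B. of_rat (c i) * x ^ i)"
      by (simp add: sum_distrib_left of_rat_mult mult.assoc)
    finally have "ipoly e x = 0" using c(1) by simp
    moreover obtain i where i: "i \<le> card B" "c i \<noteq> 0" using c(2) by blast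
    have "z i \<noteq> 0" using z[OF i(1)] i(2) N by auto
    then have "coeff e i \<noteq> 0" using i(1) by (simp add: e_def coeff_sum)
    then have "e \<noteq> 0" by auto
    ultimately show ?thesis by (auto simp: algebraic_over_Z_def)
  qed
qed

end

text \<open>Products of a spanning set of \<open>L\<close> with the powers of \<open>w\<close> below
  \<open>d\<close> span the enlarged algebra: the monic relation rewrites
  \<open>w ^ d\<close>.\<close>

lemma finite_rat_subring_adjoin:
  fixes L :: "'c::field_char_0 set"
  assumes L: "finite_rat_subring L" and "d > 0" "\<And>j. j < d \<Longrightarrow> c j \<in> L" "w ^ d = (\<Sum>j<d. c j * w ^ j)"
  obtains M where "finite_rat_subring M" "L \<subseteq> M" "w \<in> M"
proof -
  obtain B where B: "finite B" "L = rat_vs.span B" using L by (auto simp: finite_rat_subring_def)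
  define C where "C = (\<lambda>(b, j). b * w ^ j) ` (B \<times> {..<d})"
  define M where "M = rat_vs.span C"
  have sub: "rat_vs.subspace M" unfolding M_def by (rule rat_vs.subspace_span)
  have low: "l * w ^ j \<in> M" if "l \<in> L" "j < d" for l j
    using that(1) unfolding B(2)
  proof (induction rule: rat_vs.span_induct_alt)
    case base show ?case using rat_vs.subspace_0[OF sub] by simp
  next
    case (step q b y)
    have "b * w ^ j \<in> M" unfolding M_def C_def
      by (intro rat_vs.span_base) (use step.hyps that(2) in auto)
    then have "rat_scale q (b * w ^ j) + y * w ^ j \<in> M"
      by (intro rat_vs.subspace_add[OF sub] rat_vs.subspace_scale[OF sub] step.IH)
    then show ?case by (simp add: rat_scale_def algebra_simps)
  qed
  \<comment> \<open>Multiplication by \<open>a\<close> is linear, so stability of \<open>M\<close>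
    need only be tested on the spanning products.\<close>
  have linear: "a * x \<in> M" if "x \<in> M" "\<And>b j. b \<in> B \<Longrightarrow> j < d \<Longrightarrow> a * (b * w ^ j) \<in> M" for a x
    using that(1) unfolding M_def
  proof (induction rule: rat_vs.span_induct_alt)
    case base show ?case using rat_vs.span_zero by simp
  next
    case (step q b y)
    from step.hyps obtain b' j where "b' \<in> B" "j < d" "b = b' * w ^ j" unfolding C_def by auto
    then have "a * b \<in> rat_vs.span C" using that(2) unfolding M_def by simp
    then have "rat_scale q (a * b) + a * y \<in> rat_vs.span C"
      by (intro rat_vs.span_add rat_vs.span_scale step.IH)
    moreover have "a * (rat_scale q b + y) = rat_scale q (a * b) + a * y"
      by (simp add: rat_scale_def algebra_simps)
    ultimately show ?case by simp
  qed
  have BL: "B \<subseteq> L" unfolding B(2) by (rule rat_vs.span_superset)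
  have L_times: "l * x \<in> M" if "l \<in> L" "x \<in> M" for l x
    by (rule linear[OF that(2)]) (use low rat_subring_mult[OF L that(1)] BL in \<open>auto simp flip: mult.assoc\<close>)
  have w_times: "w * x \<in> M" if "x \<in> M" for x
  proof (rule linear[OF that])
    fix b j assume bj: "b \<in> B" "j < d"
    show "w * (b * w ^ j) \<in> M"
    proof (cases "Suc j < d")
      case True
      then show ?thesis using low[of b "Suc j"] bj BL by (auto simp: algebra_simps)
    next
      case False
      then have "w * (b * w ^ j) = b * w ^ d" using bj by (metis Suc_lessI mult.left_commute power_Suc)
      also have "\<dots> = (\<Sum>j<d. (b * c j) * w ^ j)" by (simp add: assms(4) sum_distrib_left mult.assoc)
      also have "\<dots> \<in> M" using bj BL assms(3) rat_subring_mult[OF L] low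
        by (intro rat_vs.subspace_sum[OF sub]) auto
      finally show ?thesis .
    qed
  qed
  have one: "1 \<in> L" using L by (simp add: finite_rat_subring_def)
  have w_power: "w ^ j * x \<in> M" if "x \<in> M" for j x
    by (induction j) (use that w_times in \<open>auto simp: mult.assoc\<close>)
  show thesis
  proof (rule that)
    show LM: "L \<subseteq> M" using low[of _ 0] assms(2) by auto
    have oneM: "1 \<in> M" using one LM by blast
    show "w \<in> M" using w_times[OF oneM] by simp
    have "x * y \<in> M" if "x \<in> M" "y \<in> M" for x y
    proof -
      have "b * w ^ j * x \<in> M" if "b \<in> B" "j < d" for b j
        using that \<open>x \<in> M\<close> BL L_times w_power by (auto simp: mult.assoc)
      then show ?thesis using linear[OF that(2), of x] by (simp add: mult.commute)
    qed
    moreover have "finite C" using B(1) by (simp add: C_def)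
    ultimately show "finite_rat_subring M" using oneM unfolding finite_rat_subring_def M_def by blast
  qed
qed

section \<open>Generation by one element\<close>

text \<open>Long division by a monic polynomial uses only differences and products of coefficients,
  so it never leaves the subring \<open>W\<close>.\<close>

lemma monic_division_in_subring:
  fixes G f :: "'c::field poly"
  assumes W: "\<And>x y. x \<in> W \<Longrightarrow> y \<in> W \<Longrightarrow> x - y \<in> W" "\<And>x y. x \<in> W \<Longrightarrow> y \<in> W \<Longrightarrow> x * y \<in> W" "0 \<in> W"
    and G: "\<And>j. coeff G j \<in> W" "lead_coeff G = 1" "degree G > 0" and f: "\<And>j. coeff f j \<in> W"
  shows "\<exists>q. degree (f - G * q) < degree G \<and> (\<forall>j. coeff (f - G * q) j \<in> W)"
  using f
proof (induction "degree f" arbitrary: f rule: less_induct)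
  case less
  show ?case
  proof (cases "degree f < degree G")
    case True
    then show ?thesis using less.prems by (intro exI[of _ 0]) auto
  next
    case False
    define t where "t = monom (lead_coeff f) (degree f - degree G)"
    have c: "coeff (f - G * t) j \<in> W" for j
      using W G(1) less.prems by (auto simp: t_def mult.commute[of G] coeff_monom_mult)
    have "degree (f - G * t) < degree f"
    proof (rule degree_lessI)
      show "f - G * t \<noteq> 0 \<or> 0 < degree f" using False G(3) by simp
      show "\<forall>k\<ge>degree f. coeff (f - G * t) k = 0"
      proof (intro allI impI)
        fix k assume k: "degree f \<le> k"
        show "coeff (f - G * t) k = 0"
        proof (cases "k = degree f")
          case True
          then show ?thesis using False G(2) by (simp add: t_def mult.commute[of G] coeff_monom_mult)
        next
          case False
          with k \<open>\<not> degree f < degree G\<close> have "coeff f k = 0" "coeff G (k - (degree f - degree G)) = 0"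
            by (auto intro!: coeff_eq_0)
          then show ?thesis by (simp add: t_def mult.commute[of G] coeff_monom_mult)
        qed
      qed
    qed
    from less.hyps[OF this c] obtain q where
      "degree (f - G * t - G * q) < degree G" "\<forall>j. coeff (f - G * t - G * q) j \<in> W" by blast
    then show ?thesis by (intro exI[of _ "t + q"]) (simp add: algebra_simps)
  qed
qed

lemma primitive_element_two:
  fixes \<alpha> \<beta> :: "'c::{alg_closed_field, field_char_0}"
  assumes L: "finite_rat_subring L" and "\<alpha> \<in> L" "\<beta> \<in> L"
  obtains \<theta> where "\<theta> \<in> L" "\<alpha> \<in> Qadj \<theta>" "\<beta> \<in> Qadj \<theta>"
proof -
  obtain a where a: "a \<noteq> 0" "ipoly a \<alpha> = 0"
    using rat_subring_algebraic[OF L assms(2)] by (auto simp: algebraic_over_Z_def)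
  obtain b where b: "b \<noteq> 0" "ipoly b \<beta> = 0"
    using rat_subring_algebraic[OF L assms(3)] by (auto simp: algebraic_over_Z_def)
  have fin: "finite {x::'c. ipoly q x = 0}" if "q \<noteq> 0" for q :: "int poly"
    unfolding ipoly_def by (rule poly_roots_finite) (use that in \<open>simp add: map_poly_eq_0_iff\<close>)
  \<comment> \<open>These are the multipliers for which another pair of roots could give the same
    \<theta>. Pairs with \<open>y = \<beta>\<close> contribute 0 by division by zero, which costs
    only the value \<open>n = 0\<close>.\<close>
  define excluded where "excluded = (\<lambda>(x, y). (x - \<alpha>) / (\<beta> - y)) ` ({x. ipoly a x = 0} \<times> {y. ipoly b y = 0})"
  have "finite excluded" unfolding excluded_def using fin a b by simp
  moreover have "infinite (range (of_int :: int \<Rightarrow> 'c))"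
    by (auto dest!: finite_imageD simp: inj_def)
  ultimately obtain n :: int where n: "of_int n \<notin> excluded" by (meson finite_subset image_subsetI)
  define \<theta> where "\<theta> = \<alpha> + of_int n * \<beta>"
  have sep: "y = \<beta>" if "ipoly a (\<theta> - of_int n * y) = 0" "ipoly b y = 0" for y
  proof (rule ccontr)
    assume "y \<noteq> \<beta>"
    then have "of_int n = (\<theta> - of_int n * y - \<alpha>) / (\<beta> - y)" by (simp add: \<theta>_def field_simps)
    moreover have "(\<theta> - of_int n * y - \<alpha>) / (\<beta> - y) \<in> excluded"
      unfolding excluded_def by (rule image_eqI[of _ _ "(\<theta> - of_int n * y, y)"]) (use that in auto)
    ultimately show False using n by simp
  qed
  have "\<theta> \<in> L" unfolding \<theta>_def by (intro rat_subring_add[OF L] rat_subring_mult[OF L] rat_subring_of_int[OF L] assms)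
  then have alg: "algebraic_over_Z x" if "x \<in> Qadj \<theta>" for x
    using Qadj_subset_rat_subring[OF L] rat_subring_algebraic[OF L] that by blast
  \<comment> \<open>\<open>A\<close> is \<open>a\<close> evaluated at \<theta> minus
    \<open>n\<close> times the variable: its coefficients lie in \<open>Qadj \<theta>\<close>, and
    \<beta> is a root because \<theta> minus \<open>n\<close> times \<beta> is \<alpha>.\<close>
  define A where "A = pcompose (map_poly of_int a) [:\<theta>, - of_int n:]"
  define B where "B = (map_poly of_int b :: 'c poly)"
  have AB: "poly A y = ipoly a (\<theta> - of_int n * y)" "poly B y = ipoly b y" for y
    by (simp_all add: A_def B_def ipoly_def poly_pcompose mult.commute)
  have pcomp: "coeff (pcompose q r) j \<in> Qadj \<theta>"
    if "\<And>j. coeff q j \<in> Qadj \<theta>" "\<And>j. coeff r j \<in> Qadj \<theta>" for q r j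
    using that(1)
  proof (induction q arbitrary: j)
    case 0 show ?case using of_int_Qadj[of 0] by simp
  next
    case (pCons c q)
    have c: "c \<in> Qadj \<theta>" using pCons.prems[of 0] by simp
    have IH: "coeff (pcompose q r) k \<in> Qadj \<theta>" for k
      using pCons.prems[of "Suc _"] by (intro pCons.IH) simp
    have sum: "sum h {..k} \<in> Qadj \<theta>" if "\<And>i. h i \<in> Qadj \<theta>" for h and k :: nat
      by (induction k) (use that in auto)
    have "coeff (r * pcompose q r) j \<in> Qadj \<theta>"
      unfolding coeff_mult by (intro sum Qadj_mult IH that(2))
    moreover have "coeff [:c:] j \<in> Qadj \<theta>"
      using c of_int_Qadj[of 0 \<theta>] by (simp add: coeff_pCons split: nat.splits)
    ultimately show ?case by (auto simp: pcompose_pCons)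
  qed
  have Acoeff: "coeff A j \<in> Qadj \<theta>" for j
    unfolding A_def
    by (rule pcomp) (auto simp: coeff_map_poly coeff_pCons of_int_Qadj[of 0, simplified] split: nat.splits)
  have Bcoeff: "coeff B j \<in> Qadj \<theta>" for j
    by (simp add: B_def coeff_map_poly)
  txt \<open>The minimal polynomial \<open>G\<close> of \<open>\<beta>\<close> over \<open>Qadj \<theta>\<close> divides both \<open>A\<close> and \<open>B\<close>, whose only common
    root is \<open>\<beta>\<close>; being separable, it is linear.\<close>
  define P where "P q \<longleftrightarrow> q \<noteq> 0 \<and> (\<forall>j. coeff q j \<in> Qadj \<theta>) \<and> poly q \<beta> = 0" for q
  have "B \<noteq> 0" using b by (simp add: B_def map_poly_eq_0_iff)
  then have "P B" using Bcoeff AB b by (auto simp: P_def)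
  then obtain G0 where G0: "P G0" "\<And>q. P q \<Longrightarrow> degree G0 \<le> degree q"
    using ex_has_least_nat[of P B degree] by blast
  define G where "G = smult (inverse (lead_coeff G0)) G0"
  have "G0 \<noteq> 0" using G0(1) by (simp add: P_def)
  then have degG: "degree G = degree G0" "lead_coeff G = 1" by (auto simp: G_def)
  have G: "\<And>j. coeff G j \<in> Qadj \<theta>" "poly G \<beta> = 0"
    using G0(1) Qadj_inverse[OF _ alg] by (auto simp: G_def P_def)
  have G_pos: "degree G > 0"
  proof (rule ccontr)
    assume "\<not> degree G > 0"
    then have "G = [:1:]" using degG(2) by (metis degree_eq_zeroE lead_coeff_pCons(2) neq0_conv)
    then show False using G(2) by simp
  qed
  have div: "G dvd f" if f: "\<And>j. coeff f j \<in> Qadj \<theta>" "poly f \<beta> = 0" for f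
  proof -
    obtain q where q: "degree (f - G * q) < degree G" "\<forall>j. coeff (f - G * q) j \<in> Qadj \<theta>"
      using monic_division_in_subring[of "Qadj \<theta>" G f] Qadj_diff Qadj_mult of_int_Qadj[of 0 \<theta>] G degG(2) G_pos f(1) by auto
    have "\<not> P (f - G * q)" using G0(2) q(1) degG(1) by (metis leD)
    then have "f - G * q = 0" using q(2) G(2) f(2) by (simp add: P_def)
    then show ?thesis by (simp add: dvd_def)
  qed
  have "poly A \<beta> = 0" "poly B \<beta> = 0" using a(2) b(2) by (simp_all add: AB \<theta>_def)
  then have "G dvd A" "G dvd B" using div Acoeff Bcoeff by blast+
  then have roots: "y = \<beta>" if "poly G y = 0" for y
    using sep[of y] that AB by (metis dvdE mult_zero_left poly_mult)
  have simple: "poly (pderiv G) \<beta> \<noteq> 0"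
  proof
    assume 0: "poly (pderiv G) \<beta> = 0"
    have c: "coeff (pderiv G) j \<in> Qadj \<theta>" for j
      using Qadj_mult[OF of_int_Qadj[of "int (Suc j)"] G(1)[of "Suc j"]] by (simp add: coeff_pderiv)
    have "pderiv G \<noteq> 0" using G_pos by (simp add: pderiv_eq_0_iff)
    with c 0 have "degree G0 \<le> degree (pderiv G)" by (intro G0(2)) (simp add: P_def)
    then show False using degG(1) G_pos by (simp add: degree_pderiv)
  qed
  obtain H where H: "G = [:- \<beta>, 1:] * H" using G(2) by (auto simp: poly_eq_0_iff_dvd)
  \<comment> \<open>Over an algebraically closed field a nonconstant \<open>H\<close> has a root. It
    could only be \<beta>, which would then be a multiple root of \<open>G\<close>.\<close>
  have "degree H = 0"
  proof (rule ccontr)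
    assume "degree H \<noteq> 0"
    then obtain y where y: "poly H y = 0" using alg_closed_imp_poly_has_root[of H] by auto
    then have "poly H \<beta> = 0" using roots[of y] H by simp
    then have "poly (pderiv G) \<beta> = 0" unfolding H
      by (simp add: pderiv_mult pderiv_pCons del: mult_pCons_left)
    with simple show False by blast
  qed
  then obtain h where "H = [:h:]" by (metis degree_eq_zeroE)
  then have "G = [:- \<beta> * h, h:]" using H by simp
  then have "G = [:- \<beta>, 1:]" using degG(2) by (cases "h = 0") auto
  then have "- \<beta> \<in> Qadj \<theta>" using G(1)[of 0] by simp
  then have \<beta>: "\<beta> \<in> Qadj \<theta>" using Qadj_uminus by fastforce
  have "\<alpha> = \<theta> - of_int n * \<beta>" by (simp add: \<theta>_def)
  also have "\<dots> \<in> Qadj \<theta>" by (intro Qadj_diff Qadj_mult \<beta>) auto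
  finally show thesis using that \<open>\<theta> \<in> L\<close> \<beta> by blast
qed

lemma Qadj_trans: assumes "\<alpha> \<in> Qadj \<theta>" shows "Qadj \<alpha> \<subseteq> Qadj \<theta>"
proof
  fix x assume "x \<in> Qadj \<alpha>"
  then obtain N q where N: "N \<noteq> 0" "of_int N * x = ipoly q \<alpha>" by (rule QadjE)
  have "ipoly q \<alpha> \<in> Qadj \<theta>"
    by (induction q) (use of_int_Qadj[of 0 \<theta>] assms in \<open>auto\<close>)
  then obtain M r where "M \<noteq> 0" "of_int M * (of_int N * x) = ipoly r \<theta>" using N QadjE by metis
  with N(1) show "x \<in> Qadj \<theta>" by (intro QadjI[of "M * N" _ r]) (auto simp: mult.assoc)
qed

lemma primitive_element:
  fixes L :: "'c::{alg_closed_field, field_char_0} set"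
  assumes L: "finite_rat_subring L"
  obtains \<theta> where "L = Qadj \<theta>"
proof -
  obtain B where B: "finite B" "L = rat_vs.span B" using L by (auto simp: finite_rat_subring_def)
  have BL: "B \<subseteq> L" unfolding B(2) by (rule rat_vs.span_superset)
  have "\<exists>\<theta>. \<theta> \<in> L \<and> B \<subseteq> Qadj \<theta>" using B(1) BL
  proof (induction B rule: finite_induct)
    case empty show ?case using rat_subring_of_int[OF L] by auto
  next
    case (insert b B)
    then obtain \<alpha> where \<alpha>: "\<alpha> \<in> L" "B \<subseteq> Qadj \<alpha>" by auto
    obtain \<theta> where "\<theta> \<in> L" "\<alpha> \<in> Qadj \<theta>" "b \<in> Qadj \<theta>"
      using primitive_element_two[OF L \<alpha>(1), of b] insert.prems by blast
    then show ?case using \<alpha>(2) Qadj_trans by blast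
  qed
  then obtain \<theta> where \<theta>: "\<theta> \<in> L" "B \<subseteq> Qadj \<theta>" by blast
  have "L \<subseteq> Qadj \<theta>" unfolding B(2)
  proof (rule rat_vs.span_minimal[OF \<theta>(2)])
    have "of_rat q * x \<in> Qadj \<theta>" if "x \<in> Qadj \<theta>" for q x
    proof -
      obtain u v where uv: "v \<noteq> 0" "q = of_int u / of_int v"
        by (metis quotient_of_div quotient_of_denom_pos less_irrefl surj_pair)
      then have "of_rat q \<in> Qadj \<theta>" by (intro QadjI[of v _ "[:u:]"]) (auto simp: of_rat_divide)
      with that show ?thesis by blast
    qed
    then show "rat_vs.subspace (Qadj \<theta>)"
      using of_int_Qadj[of 0 \<theta>] by (auto simp: rat_vs.subspace_def rat_scale_def)
  qed
  then show thesis using Qadj_subset_rat_subring[OF L \<theta>(1)] that by blast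
qed

text \<open>Choose \<open>n\<close> off the zeros of the derivative: then \<open>n\<close> is a
  simple root of \<open>g\<close> minus its value there, and since the degree is at least 2, another
  root exists.\<close>

lemma noninjective_value:
  fixes g :: "'c::{alg_closed_field, field_char_0} poly"
  assumes "degree g \<ge> 2"
  obtains n w where "w \<noteq> of_int n" "poly g w = poly g (of_int n)"
proof -
  have "pderiv g \<noteq> 0" using assms by (simp add: pderiv_eq_0_iff)
  then have "finite {x. poly (pderiv g) x = 0}" by (rule poly_roots_finite)
  moreover have "infinite (range (of_int :: int \<Rightarrow> 'c))"
    by (auto dest!: finite_imageD simp: inj_def)
  ultimately obtain n :: int where n: "poly (pderiv g) (of_int n) \<noteq> 0"
    by (metis (mono_tags, lifting) finite_subset image_subsetI mem_Collect_eq)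
  define f where "f = g + [:- poly g (of_int n):]"
  have "poly f (of_int n) = 0" by (simp add: f_def)
  then obtain h where h: "f = [:- of_int n, 1:] * h" by (auto simp: poly_eq_0_iff_dvd)
  have "degree f = degree g" unfolding f_def
    using degree_add_eq_left[of "[:- poly g (of_int n):]" g] assms by simp
  moreover have "h \<noteq> 0" using h calculation assms by auto
  then have "degree f = Suc (degree h)" unfolding h by (subst degree_mult_eq) auto
  ultimately have "degree h > 0" using assms by simp
  then obtain w where w: "poly h w = 0" using alg_closed_imp_poly_has_root by blast
  have "w \<noteq> of_int n"
  proof
    assume "w = of_int n"
    then have "poly (pderiv f) (of_int n) = 0" unfolding h using w
      by (simp add: pderiv_mult pderiv_pCons del: mult_pCons_left)
    then show False using n by (simp add: f_def pderiv_add pderiv_pCons)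
  qed
  moreover have "poly f w = 0" using w by (simp add: h)
  then have "poly g w = poly g (of_int n)" by (simp add: f_def)
  ultimately show thesis using that by blast
qed

section \<open>Coefficients avoiding roots\<close>

lemma rat_subring_sum:
  "finite_rat_subring L \<Longrightarrow> (\<And>i. i \<in> A \<Longrightarrow> f i \<in> L) \<Longrightarrow> sum f A \<in> L"
  by (rule rat_vs.subspace_sum[OF rat_subring_subspace])

text \<open>The colliding point \<open>w\<close> may lie outside \<open>L\<close>, so it is adjoined
  first; avoiding roots in the larger field \<open>M\<close> suffices.\<close>

lemma constant_avoiding_roots:
  fixes L :: "'c::{alg_closed_field, field_char_0} set"
  assumes L: "finite_rat_subring L" and inv: "\<And>x. x \<in> L \<Longrightarrow> inverse x \<in> L"
    and g: "\<And>j. coeff g j \<in> L" "degree g \<ge> 2"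
  obtains a where "a > 0" "\<And>x. x \<in> L \<Longrightarrow> poly (g + [:of_int a:]) x \<noteq> 0"
proof -
  obtain n w where w: "w \<noteq> of_int n" "poly g w = poly g (of_int n)"
    using noninjective_value[OF g(2)] by blast
  define d where "d = degree g"
  define f where "f = g + [:- poly g (of_int n):]"
  \<comment> \<open>Dividing \<open>f\<close>, which vanishes at \<open>w\<close>, by its leading
    coefficient gives the monic relation needed to adjoin \<open>w\<close>.\<close>
  define c where "c j = - coeff f j * inverse (lead_coeff g)" for j
  have "poly g (of_int n) \<in> L"
    unfolding poly_altdef by (intro rat_subring_sum[OF L] rat_subring_mult[OF L] rat_subring_power[OF L] rat_subring_of_int[OF L] g)
  then have "coeff f j \<in> L" for j
    using g(1)[of j] rat_subring_add[OF L g(1)[of j] rat_subring_uminus[OF L]] by (auto simp: f_def coeff_pCons split: nat.splits)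
  then have c: "c j \<in> L" for j
    unfolding c_def by (intro rat_subring_mult[OF L] rat_subring_uminus[OF L] inv g)
  have lead: "lead_coeff g \<noteq> 0" using g(2) by auto
  have deg: "degree f = d" "coeff f d = lead_coeff g"
    using degree_add_eq_left[of "[:- poly g (of_int n):]" g] g(2)
    by (auto simp: f_def d_def coeff_pCons split: nat.splits)
  have "0 = poly f w" using w by (simp add: f_def)
  also have "\<dots> = lead_coeff g * w ^ d + (\<Sum>j<d. coeff f j * w ^ j)"
    by (simp add: poly_altdef deg flip: lessThan_Suc_atMost)
  finally have "w ^ d = - inverse (lead_coeff g) * (\<Sum>j<d. coeff f j * w ^ j)"
    using lead by (simp add: field_simps eq_neg_iff_add_eq_0)
  also have "\<dots> = (\<Sum>j<d. c j * w ^ j)"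
    by (simp add: c_def sum_distrib_left sum_negf mult_ac)
  finally obtain M where M: "finite_rat_subring M" "L \<subseteq> M" "w \<in> M"
    using finite_rat_subring_adjoin[OF L, of d c w] c g(2) by (auto simp: d_def)
  obtain \<theta> where \<theta>: "M = Qadj \<theta>" using primitive_element[OF M(1)] .
  have alg: "\<And>x. x \<in> Qadj \<theta> \<Longrightarrow> algebraic_over_Z x" using rat_subring_algebraic[OF M(1)] \<theta> by simp
  have deg_pos: "degree g > 0" using g(2) by simp
  have "coeff g j \<in> Qadj \<theta>" for j using g(1) M(2) \<theta> by auto
  moreover have "of_int n \<in> Qadj \<theta>" "w \<in> Qadj \<theta>" using M(3) \<theta> by auto
  ultimately obtain a where "a > 0" "\<And>x. x \<in> Qadj \<theta> \<Longrightarrow> poly (g + [:of_int a:]) x \<noteq> 0"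
    using integer_coeff_avoiding_roots_constant[of \<theta> g "of_int n" w] alg w deg_pos by metis
  then show thesis using that M(2) \<theta> by blast
qed

lemma coefficient_avoiding_roots:
  fixes L :: "'c::{alg_closed_field, field_char_0} set"
  assumes L: "finite_rat_subring L" and inv: "\<And>x. x \<in> L \<Longrightarrow> inverse x \<in> L"
    and g: "\<And>j. coeff g j \<in> L" "degree g \<le> d" and d: "d \<ge> 2" and i: "i \<le> d"
    and ends: "i \<noteq> 0 \<Longrightarrow> coeff g 0 \<noteq> 0" "i \<noteq> d \<Longrightarrow> coeff g d \<noteq> 0"
  obtains a where "a > 0" "\<And>x. x \<in> L \<Longrightarrow> poly (g + monom (of_int a) i) x \<noteq> 0"
proof -
  consider "i = 0" | "i = d" | "0 < i" "i < d" using i by linarith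
  then show thesis
  proof cases
    case 1
    then have "degree g \<ge> 2" using ends(2) d by (metis le_degree le_trans neq0_conv not_numeral_le_zero)
    then show thesis using constant_avoiding_roots[OF L inv g(1)] that 1 by (metis monom_0)
  next
    case 3
    then have deg: "degree g = d" using ends(2) g(2) by (metis le_antisym le_degree less_irrefl)
    obtain \<theta> where \<theta>: "L = Qadj \<theta>" using primitive_element[OF L] .
    have alg: "\<And>x. x \<in> Qadj \<theta> \<Longrightarrow> algebraic_over_Z x" using rat_subring_algebraic[OF L] \<theta> by simp
    show thesis
      using integer_coeff_avoiding_roots_middle[OF alg, of \<theta> g i] g(1) ends(1) 3 deg that \<theta> by auto
  next
    case 2
    \<comment> \<open>The reversal of \<open>g\<close> taken in degree \<open>d\<close>: the power
      of X compensates for \<open>g\<close> having possibly smaller degree. An open leading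
      coefficient of \<open>g\<close> becomes the constant one of \<open>h\<close>, and roots are
      inverted.\<close>
    define h where "h = monom 1 (d - degree g) * reflect_poly g"
    have g0: "coeff g 0 \<noteq> 0" using ends(1) 2 d by simp
    have "degree h = d"
      using g0 g(2) unfolding h_def by (subst degree_mult_eq) (auto simp: degree_monom_eq)
    moreover have "coeff h j \<in> L" for j
      using g(1) rat_subring_of_int[OF L, of 0] by (auto simp: h_def coeff_monom_mult coeff_reflect_poly)
    ultimately obtain a where a: "a > 0" "\<And>x. x \<in> L \<Longrightarrow> poly (h + [:of_int a:]) x \<noteq> 0"
      using constant_avoiding_roots[OF L inv, of h] d by auto
    have "poly (g + monom (of_int a) i) x \<noteq> 0" if x: "x \<in> L" for x
    proof
      assume 0: "poly (g + monom (of_int a) i) x = 0"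
      have x0: "x \<noteq> 0" using 0 g0 2 d by (auto simp: poly_monom poly_0_coeff_0 power_0_left)
      have "x ^ d * poly h (inverse x) = x ^ d * (inverse x ^ (d - degree g) * inverse x ^ degree g) * poly g x"
        using poly_reflect_poly_nz[of "inverse x" g] x0 by (simp add: h_def poly_monom mult_ac)
      also have "\<dots> = poly g x"
        using g(2) x0 by (simp add: flip: power_add) (simp add: power_inverse)
      finally have "x ^ d * poly (h + [:of_int a:]) (inverse x) = 0"
        using 0 2 by (simp add: algebra_simps poly_monom)
      then show False using a(2)[OF inv[OF x]] x0 by simp
    qed
    with a(1) show thesis using that by blast
  qed
qed

section \<open>Passage to the algebraic closure and to the field of fractions\<close>

lemma to_ac_of_rat: "to_ac (of_rat q :: 'k::field_char_0) = of_rat q"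
proof -
  obtain u v where "q = of_int u / of_int v" by (metis quotient_of_div surj_pair)
  then show ?thesis by (simp add: of_rat_divide)
qed

text \<open>The given field is replaced by its copy inside the algebraic closure, where the extra
  roots can be found.\<close>

lemma finite_rat_subring_range_to_ac:
  assumes "finite_extension_of_rats TYPE('k::field_char_0)"
  shows "finite_rat_subring (range (to_ac :: 'k \<Rightarrow> 'k alg_closure))"
proof -
  obtain B :: "'k set" where B: "finite B" "rat_vs.span B = UNIV"
    using assms by (auto simp: finite_extension_of_rats_def)
  have scale: "to_ac (rat_scale q x) = rat_scale q (to_ac x)" for q and x :: 'k
    by (simp add: rat_scale_def to_ac_of_rat)
  have "to_ac x \<in> rat_vs.span (to_ac ` B)" for x
  proof -
    have "x \<in> rat_vs.span B" using B(2) by simp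
    then show ?thesis
    proof (induction rule: rat_vs.span_induct_alt)
      case base show ?case using rat_vs.span_zero by simp
    next
      case (step q b y)
      have "rat_scale q (to_ac b) + to_ac y \<in> rat_vs.span (to_ac ` B)"
        by (intro rat_vs.span_add rat_vs.span_scale rat_vs.span_base step imageI)
      then show ?case by (simp add: scale)
    qed
  qed
  moreover have "rat_vs.span (to_ac ` B) \<subseteq> range (to_ac :: 'k \<Rightarrow> _)"
  proof (rule rat_vs.span_minimal)
    have "\<exists>z. to_ac x + to_ac y = to_ac z" for x y :: 'k by (metis to_ac_add)
    moreover have "\<exists>z. rat_scale q (to_ac x) = to_ac z" for q and x :: 'k by (metis scale)
    ultimately show "rat_vs.subspace (range (to_ac :: 'k \<Rightarrow> _))"
      by (auto simp: rat_vs.subspace_def image_iff)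
  qed auto
  ultimately have "range to_ac = rat_vs.span (to_ac ` B)" by blast
  moreover have "1 \<in> range (to_ac :: 'k \<Rightarrow> _)" by (metis rangeI to_ac_1)
  moreover have "to_ac x * to_ac y \<in> range to_ac" for x y :: 'k by (metis rangeI to_ac_mult)
  ultimately show ?thesis using B(1) unfolding finite_rat_subring_def by blast
qed

lemma poly_eq_sum_bound:
  fixes f :: "'a::comm_semiring_1 poly"
  shows "degree f \<le> n \<Longrightarrow> poly f x = (\<Sum>j\<le>n. coeff f j * x ^ j)"
  unfolding poly_altdef by (intro sum.mono_neutral_left) (auto simp: coeff_eq_0)

lemma ring_embeddingD:
  assumes "ring_embedding \<phi>"
  shows "\<phi> (x + y) = \<phi> x + \<phi> y" "\<phi> (x * y) = \<phi> x * \<phi> y" "\<phi> 1 = 1" "\<phi> 0 = 0"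
    "\<phi> x = 0 \<longleftrightarrow> x = 0" "\<phi> (x ^ n) = \<phi> x ^ n" "\<phi> (sum f A) = (\<Sum>i\<in>A. \<phi> (f i))"
    "\<phi> (of_int k) = of_int k"
proof -
  show add: "\<phi> (x + y) = \<phi> x + \<phi> y" for x y using assms by (simp add: ring_embedding_def)
  show mult: "\<phi> (x * y) = \<phi> x * \<phi> y" for x y using assms by (simp add: ring_embedding_def)
  show 1: "\<phi> 1 = 1" using assms by (simp add: ring_embedding_def)
  show 0: "\<phi> 0 = 0" using add[of 0 0] by (metis add.right_neutral add_left_imp_eq)
  show "\<phi> x = 0 \<longleftrightarrow> x = 0" using assms 0 by (metis injD ring_embedding_def)
  show "\<phi> (x ^ n) = \<phi> x ^ n" by (induction n) (simp_all add: 1 mult)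
  show "\<phi> (sum f A) = (\<Sum>i\<in>A. \<phi> (f i))"
    by (induction A rule: infinite_finite_induct) (simp_all add: 0 add)
  have uminus: "\<phi> (- x) = - \<phi> x" for x using add[of x "- x"] 0 by (simp add: eq_neg_iff_add_eq_0 add.commute)
  have nat: "\<phi> (of_nat n) = of_nat n" for n by (induction n) (simp_all add: 0 1 add)
  show "\<phi> (of_int k) = of_int k" by (cases k) (simp_all add: nat uminus 1 add del: of_nat_Suc)
qed

lemma ring_embedding_to_fract: "ring_embedding to_fract"
  by (simp add: ring_embedding_def inj_def)

text \<open>Homogenisation clears the denominators. An arbitrary embedding is allowed, so that the
  identity serves both the field of fractions and the algebraic closure.\<close>

lemma poly_map_poly_quotient:
  assumes \<phi>: "ring_embedding \<phi>" and "degree f \<le> n" "v \<noteq> 0"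
  shows "poly (map_poly \<phi> f) (\<phi> u / \<phi> v) * \<phi> v ^ n = \<phi> (\<Sum>j\<le>n. coeff f j * u ^ j * v ^ (n - j))"
proof -
  note [simp] = ring_embeddingD[OF \<phi>]
  have "degree (map_poly \<phi> f) \<le> n"
    using assms(2) by (intro degree_le) (auto simp: coeff_map_poly coeff_eq_0)
  then have "poly (map_poly \<phi> f) (\<phi> u / \<phi> v) * \<phi> v ^ n =
      (\<Sum>j\<le>n. \<phi> (coeff f j) * (\<phi> u / \<phi> v) ^ j * \<phi> v ^ n)"
    by (simp add: poly_eq_sum_bound coeff_map_poly sum_distrib_right)
  also have "\<dots> = (\<Sum>j\<le>n. \<phi> (coeff f j * u ^ j * v ^ (n - j)))"
    using assms(3) by (intro sum.cong) (simp_all add: power_divide power_diff field_simps)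
  finally show ?thesis by simp
qed

text \<open>This expresses roots by equations inside the domain itself, which can be carried along
  any embedding.\<close>

lemma root_in_fract_iff:
  assumes "degree f \<le> n"
  shows "has_root_in_fract f \<longleftrightarrow> (\<exists>u v. v \<noteq> 0 \<and> (\<Sum>j\<le>n. coeff f j * u ^ j * v ^ (n - j)) = 0)"
proof -
  note [simp] = ring_embeddingD[OF ring_embedding_to_fract]
  have "poly (map_poly to_fract f) (Fract u v) = 0 \<longleftrightarrow> (\<Sum>j\<le>n. coeff f j * u ^ j * v ^ (n - j)) = 0"
    if "v \<noteq> 0" for u v
  proof -
    have "poly (map_poly to_fract f) (Fract u v) = 0 \<longleftrightarrow>
        poly (map_poly to_fract f) (Fract u v) * to_fract v ^ n = 0"
      using that by simp
    also have "\<dots> \<longleftrightarrow> to_fract (\<Sum>j\<le>n. coeff f j * u ^ j * v ^ (n - j)) = 0"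
      using poly_map_poly_quotient[OF ring_embedding_to_fract assms that, of u]
      by (simp only: Fract_conv_to_fract)
    finally show ?thesis by (simp only: to_fract_eq_0_iff)
  qed
  then show ?thesis unfolding has_root_in_fract_def by (metis Fract_cases)
qed

section \<open>The last move\<close>

lemma legal_history_snoc:
  "legal_history d (ms @ [m]) \<longleftrightarrow> legal_history d ms \<and> legal_move d ms m"
  by (auto simp: legal_history_def nth_append less_Suc_eq)

lemma legal_history_take: "legal_history d ms \<Longrightarrow> legal_history d (take k ms)"
  by (auto simp: legal_history_def min_def)

lemma game_poly_snoc: "game_poly (ms @ [(i, a)]) = game_poly ms + monom a i"
  by (simp add: game_poly_def)

text \<open>Each index is played at most once, so the monomials of \<open>game_poly\<close> do not
  interact and legality becomes a statement about coefficients.\<close>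

lemma legal_history_coeffs:
  assumes "legal_history d ms"
  shows "card (fst ` set ms) = length ms \<and> fst ` set ms \<subseteq> {..d} \<and>
    (\<forall>j. j \<notin> fst ` set ms \<longrightarrow> coeff (game_poly ms) j = 0) \<and>
    (\<forall>j. j \<in> fst ` set ms \<longrightarrow> j = 0 \<or> j = d \<longrightarrow> coeff (game_poly ms) j \<noteq> 0)"
  using assms
proof (induction ms rule: rev_induct)
  case Nil
  show ?case by (simp add: game_poly_def)
next
  case (snoc m ms)
  obtain i a where m: "m = (i, a)" by fastforce
  have "legal_history d ms" "legal_move d ms m" using snoc.prems by (auto simp: legal_history_snoc)
  then show ?case using snoc.IH by (auto simp: legal_move_def game_poly_snoc m card_insert_if)
qed

lemma legal_move_exists:
  fixes ms :: "'a::idom history"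
  assumes "legal_history d ms" "length ms < d + 1"
  shows "\<exists>m. legal_move d ms m"
proof -
  have "card (fst ` set ms) < card {..d}" using legal_history_coeffs[OF assms(1)] assms(2) by simp
  then have "\<not> {..d} \<subseteq> fst ` set ms" by (meson List.finite_set card_mono finite_imageI leD)
  then obtain i where "i \<le> d" "i \<notin> fst ` set ms" by auto
  then have "legal_move d ms (i, 1)" by (simp add: legal_move_def)
  then show ?thesis by blast
qed

section \<open>Completing the polynomial for either player\<close>

text \<open>The open coefficient enters linearly, so a root can be prescribed and the coefficient
  solved for. At the two ends the root is chosen to make the solution nonzero, which is possible in
  an infinite domain.\<close>

lemma root_forcing_coefficient:
  fixes g :: "'a::idom poly"
  assumes inf: "infinite (UNIV :: 'a set)" and g: "degree g \<le> d" "d \<ge> 2" "i \<le> d"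
    and ends: "i \<noteq> 0 \<Longrightarrow> coeff g 0 \<noteq> 0" "i \<noteq> d \<Longrightarrow> coeff g d \<noteq> 0"
  obtains a where "i = 0 \<or> i = d \<Longrightarrow> a \<noteq> 0" "has_root_in_fract (g + monom a i)"
proof -
  have nonroot: "\<exists>x. poly q x \<noteq> 0" if "q \<noteq> 0" for q :: "'a poly"
    using poly_roots_finite[OF that] inf by (metis (mono_tags, lifting) UNIV_eq_I mem_Collect_eq)
  have root: "has_root_in_fract (g + monom a i)"
    if "v \<noteq> 0" "(\<Sum>j\<le>d. coeff g j * u ^ j * v ^ (d - j)) + a * u ^ i * v ^ (d - i) = 0" for a u v
  proof -
    have "(\<Sum>j\<le>d. coeff (g + monom a i) j * u ^ j * v ^ (d - j)) =
      (\<Sum>j\<le>d. coeff g j * u ^ j * v ^ (d - j)) + (\<Sum>j\<le>d. if j = i then a * u ^ i * v ^ (d - i) else 0)"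
      unfolding sum.distrib[symmetric] by (intro sum.cong) (auto simp: algebra_simps)
    moreover have "degree (g + monom a i) \<le> d"
      using g degree_monom_le[of a i] by (intro degree_add_le) auto
    ultimately show ?thesis
      using that g(3) by (subst root_in_fract_iff) auto
  qed
  consider "i = 0" | "i = d" | "0 < i" "i < d" using g(3) by linarith
  then show thesis
  proof cases
    case 1
    then have "g \<noteq> 0" using ends(2) g(2) by auto
    then obtain x where "poly g x \<noteq> 0" using nonroot by blast
    then show thesis using root[of 1 x "- poly g x"] 1 that[of "- poly g x"]
      by (simp add: poly_eq_sum_bound[OF g(1)])
  next
    case 2
    define Q where "Q = (\<Sum>j\<le>d. monom (coeff g j) (d - j))"
    have Q: "poly Q y = (\<Sum>j\<le>d. coeff g j * y ^ (d - j))" for y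
      by (simp add: Q_def poly_sum poly_monom)
    have "coeff Q d = (\<Sum>j\<le>d. if j = 0 then coeff g 0 else 0)"
      unfolding Q_def coeff_sum by (intro sum.cong) (use g(2) in auto)
    then have "coeff Q d \<noteq> 0" using ends(1) 2 g(2) by simp
    \<comment> \<open>The extra factor X ensures that \<open>y\<close> is nonzero, so that 1 over
      \<open>y\<close> can be the root.\<close>
    then have "[:0, 1:] * Q \<noteq> 0" by auto
    then obtain y where "poly ([:0, 1:] * Q) y \<noteq> 0" using nonroot by blast
    then show thesis using root[of y 1 "- poly Q y"] 2 that[of "- poly Q y"] by (simp add: Q)
  next
    case 3
    then show thesis using root[of 1 1 "- poly g 1"] that[of "- poly g 1"]
      by (simp add: poly_eq_sum_bound[OF g(1)])
  qed
qed

text \<open>A root \<open>u\<close> over \<open>v\<close> in the field of fractions would map to a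
  root in the copy of the extension field, and an integer coefficient avoiding all of those is
  available.\<close>

lemma root_avoiding_coefficient:
  fixes h :: "'a::idom \<Rightarrow> 'k::field_char_0" and g :: "'a poly"
  assumes K: "finite_extension_of_rats TYPE('k)" and h: "ring_embedding h"
    and g: "degree g \<le> d" "d \<ge> 2" "i \<le> d"
    and ends: "i \<noteq> 0 \<Longrightarrow> coeff g 0 \<noteq> 0" "i \<noteq> d \<Longrightarrow> coeff g d \<noteq> 0"
  obtains a where "a \<noteq> 0" "\<not> has_root_in_fract (g + monom a i)"
proof -
  define \<phi> where "\<phi> x = to_ac (h x)" for x
  have \<phi>: "ring_embedding \<phi>"
    using h by (auto simp: ring_embedding_def \<phi>_def inj_def)
  note [simp] = ring_embeddingD[OF \<phi>]
  let ?L = "range (to_ac :: 'k \<Rightarrow> _)"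
  have L: "finite_rat_subring ?L" by (rule finite_rat_subring_range_to_ac[OF K])
  have inv: "inverse x \<in> ?L" if "x \<in> ?L" for x using that by (metis imageE rangeI to_ac_inverse)
  have "degree (map_poly \<phi> g) \<le> d"
    using g(1) by (intro degree_le) (auto simp: coeff_map_poly coeff_eq_0)
  moreover have "coeff (map_poly \<phi> g) j \<in> ?L" for j
    by (simp add: coeff_map_poly) (simp add: \<phi>_def)
  moreover have "coeff (map_poly \<phi> g) j \<noteq> 0 \<longleftrightarrow> coeff g j \<noteq> 0" for j
    by (simp add: coeff_map_poly)
  ultimately obtain a where a: "a > 0" "\<And>x. x \<in> ?L \<Longrightarrow> poly (map_poly \<phi> g + monom (of_int a) i) x \<noteq> 0"
    using coefficient_avoiding_roots[of ?L "map_poly \<phi> g" d i] L inv g(2,3) ends by metis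
  define f where "f = g + monom (of_int a) i"
  have f: "map_poly \<phi> f = map_poly \<phi> g + monom (of_int a) i"
    by (rule poly_eqI) (simp add: coeff_map_poly f_def)
  have deg: "degree f \<le> d"
    unfolding f_def by (intro degree_add_le order.trans[OF degree_monom_le] g)
  have "\<not> has_root_in_fract f"
  proof
    assume "has_root_in_fract f"
    then obtain u v where uv: "v \<noteq> 0" "(\<Sum>j\<le>d. coeff f j * u ^ j * v ^ (d - j)) = 0"
      using root_in_fract_iff[OF deg] by blast
    have "poly (map_poly \<phi> f) (\<phi> u / \<phi> v) * \<phi> v ^ d = \<phi> 0"
      using poly_map_poly_quotient[OF \<phi> deg uv(1), of u] by (simp only: uv(2))
    then have "poly (map_poly \<phi> f) (\<phi> u / \<phi> v) = 0" using uv(1) by simp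
    moreover have "\<phi> u / \<phi> v \<in> ?L" by (metis \<phi>_def rangeI to_ac_divide)
    ultimately show False using a(2) f by simp
  qed
  moreover have "\<phi> (of_int a) \<noteq> 0" using a(1) by simp
  then have "(of_int a :: 'a) \<noteq> 0" by (simp only: ring_embeddingD(5)[OF \<phi>] not_False_eq_True)
  ultimately show thesis using that by (simp add: f_def)
qed

lemma winning_last_move:
  fixes h :: "'a::idom \<Rightarrow> 'k::field_char_0" and ms :: "'a history"
  assumes K: "finite_extension_of_rats TYPE('k)" and h: "ring_embedding h" and d: "d \<ge> 2"
    and ms: "legal_history d ms" "length ms = d"
  shows "\<exists>m. legal_move d ms m \<and> won_by P (game_poly (ms @ [m]))"
proof -
  define g where "g = game_poly ms"
  have facts: "card (fst ` set ms) = d" "fst ` set ms \<subseteq> {..d}"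
    "\<And>j. j \<notin> fst ` set ms \<Longrightarrow> coeff g j = 0"
    "\<And>j. j \<in> fst ` set ms \<Longrightarrow> j = 0 \<or> j = d \<Longrightarrow> coeff g j \<noteq> 0"
    using legal_history_coeffs[OF ms(1)] ms(2) by (auto simp: g_def)
  have "card ({..d} - fst ` set ms) = 1"
    using facts(1,2) by (subst card_Diff_subset) auto
  then obtain i where "{..d} - fst ` set ms = {i}" by (auto simp: card_1_singleton_iff)
  then have i: "i \<le> d" "i \<notin> fst ` set ms" "\<And>j. j \<le> d \<Longrightarrow> j \<noteq> i \<Longrightarrow> j \<in> fst ` set ms" by blast+
  have deg: "degree g \<le> d"
    using facts(2) by (intro degree_le allI impI facts(3)) auto
  have ends: "i \<noteq> 0 \<Longrightarrow> coeff g 0 \<noteq> 0" "i \<noteq> d \<Longrightarrow> coeff g d \<noteq> 0"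
    using facts(4) i(3) by auto
  \<comment> \<open>The domain inherits characteristic 0 through \<open>h\<close>, hence is
    infinite.\<close>
  have "inj (of_nat :: nat \<Rightarrow> 'a)"
  proof (rule injI)
    fix m n assume "(of_nat m :: 'a) = of_nat n"
    then have "h (of_int (int m)) = h (of_int (int n))" by simp
    then show "m = n" by (simp only: ring_embeddingD(8)[OF h] of_int_eq_iff of_nat_eq_iff)
  qed
  then have inf: "infinite (UNIV :: 'a set)" by (meson finite_imageD finite_subset infinite_UNIV_nat subset_UNIV)
  have "\<exists>a. (i = 0 \<or> i = d \<longrightarrow> a \<noteq> 0) \<and> won_by P (g + monom a i)"
  proof (cases P)
    case Wanda
    then show ?thesis using root_forcing_coefficient[OF inf deg d i(1) ends] by auto
  next
    case Nora
    then show ?thesis using root_avoiding_coefficient[OF K h deg d i(1) ends] by auto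
  qed
  then obtain a where "i = 0 \<or> i = d \<longrightarrow> a \<noteq> 0" "won_by P (g + monom a i)" by blast
  then have "legal_move d ms (i, a)" "won_by P (game_poly (ms @ [(i, a)]))"
    using i by (auto simp: legal_move_def game_poly_snoc g_def)
  then show ?thesis by blast
qed

theorem theorem5p1:
  fixes h :: "'a::idom \<Rightarrow> 'k::field_char_0" and d :: nat and first :: player
  assumes "finite_extension_of_rats TYPE('k)"
    and "ring_embedding h"
    and "d \<ge> 2"
  shows "\<exists>\<sigma> :: 'a history \<Rightarrow> nat \<times> 'a. winning_strategy d first (last_player d first) \<sigma>"
proof -
  let ?P = "last_player d first"
  \<comment> \<open>Only the move after \<open>d\<close> earlier ones must win; before that any
    legal move will do.\<close>
  define wins where "wins ms m \<longleftrightarrow>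
    legal_move d ms m \<and> (length ms = d \<longrightarrow> won_by ?P (game_poly (ms @ [m])))" for ms and m :: "nat \<times> 'a"
  define \<sigma> where "\<sigma> ms = (SOME m. wins ms m)" for ms
  have \<sigma>: "wins ms (\<sigma> ms)" if "legal_history d ms" "length ms < d + 1" for ms
    unfolding \<sigma>_def
  proof (rule someI_ex)
    show "\<exists>m. wins ms m"
      using winning_last_move[OF assms that(1)] legal_move_exists[OF that]
      by (cases "length ms = d") (auto simp: wins_def)
  qed
  have "won_by ?P (game_poly ms)"
    if ms: "legal_history d ms" "follows first ?P \<sigma> ms" "length ms = d + 1" for ms
  proof -
    have "ms ! d = \<sigma> (take d ms)" using ms by (simp add: follows_def last_player_def)
    moreover have "ms = take d ms @ [ms ! d]" using ms(3) by (simp flip: take_Suc_conv_app_nth)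
    ultimately show ?thesis
      using \<sigma>[OF legal_history_take[OF ms(1), of d]] ms(3) by (simp add: wins_def)
  qed
  then have "winning_strategy d first ?P \<sigma>"
    using \<sigma> by (simp add: winning_strategy_def wins_def)
  then show ?thesis by blast
qed

end
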